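(* Let $H:\mathbb R_+\to(0,1)$ be continuous and satisfy: (H1) there are constants $0<h_1<h_2<1$ with $h_1\le H_t\le h_2$ for all $t\ge0$; (H2) there are constants $D>0$, $\kappa\in(0,1]$ with $|H_t-H_s|\le D|t-s|^\kappa$ for all $t\ge s>0$; and assume $\min\{h_1,\kappa\}>1/2$. Let $Y$ be the multifractional Brownian motion with Hurst function $H$, $x_0\in\mathbb R$, and let $X$ be the (unique) solution of $X_t=x_0+\theta\int_0^tX_s\,ds+Y_t$, $t\ge0$, with $\theta>0$. Define \[ \hat\theta_T=\frac{\int_0^TX_s\,dX_s}{\int_0^TX_s^2\,ds}. \] Then $\hat\theta_T\to\theta$ almost surely as $T\to\infty$.
   Context: The (harmonizable) multifractional Brownian motion with continuous functional parameter $H$ is $Y(t)=\int_{\mathbb R}\frac{e^{itu}-1}{|u|^{H_t+1/2}}\widetilde W(du)$, $t\ge0$, where $\widetilde W$ is the Fourier transform of real Gaussian white noise $W$ (the unique complex-valued random measure with $\int f\,dW=\int\widehat f\,d\widetilde W$ a.s. for all $f\in L^2(\mathbb R)$). Under the assumptions, the trajectories of $Y$ and $X$ are a.s. Hölder continuous of every order less than $\min\{h_1,\kappa\}>1/2$ on bounded intervals, and $\int_0^TX_s\,dX_s$ is the pathwise (Riemann–Stieltjes/Young-type) integral, i.e. the a.s. limit of Riemann sums. *)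

theory Defs
  imports "HOL-Probability.Probability"
begin

text \<open>Covariance of the harmonizable multifractional Brownian motion with Hurst
function H, with Fourier convention hat f(u) = int e^{ixu} f(x) dx, so that
E[Y_t Y_s] = (1/(2 pi)) int (e^{itu}-1) conj(e^{isu}-1) / |u|^{H_t+H_s+1} du.\<close>
definition mbm_cov :: "(real \<Rightarrow> real) \<Rightarrow> real \<Rightarrow> real \<Rightarrow> real" where
  "mbm_cov H t s = (1 / (2 * pi)) * Re (LINT u|lborel.
      (exp (\<i> * complex_of_real (t * u)) - 1) * (exp (- \<i> * complex_of_real (s * u)) - 1)
      / complex_of_real (\<bar>u\<bar> powr (H t + H s + 1)))"

definition centered_normal_rv :: "'a measure \<Rightarrow> ('a \<Rightarrow> real) \<Rightarrow> real \<Rightarrow> bool" where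
  "centered_normal_rv M Z v \<longleftrightarrow> Z \<in> borel_measurable M \<and>
     (if v = 0 then (AE \<omega> in M. Z \<omega> = 0)
      else v > 0 \<and> distributed M lborel Z (normal_density 0 (sqrt v)))"

definition centered_gaussian_process ::
  "'a measure \<Rightarrow> (real \<Rightarrow> 'a \<Rightarrow> real) \<Rightarrow> (real \<Rightarrow> real \<Rightarrow> real) \<Rightarrow> bool" where
  "centered_gaussian_process M Y K \<longleftrightarrow>
     (\<forall>n (ts :: nat \<Rightarrow> real) (cs :: nat \<Rightarrow> real). (\<forall>i<n. ts i \<ge> 0) \<longrightarrow>
        centered_normal_rv M (\<lambda>\<omega>. \<Sum>i<n. cs i * Y (ts i) \<omega>)
          (\<Sum>i<n. \<Sum>j<n. cs i * cs j * K (ts i) (ts j)))"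

definition mbm :: "'a measure \<Rightarrow> (real \<Rightarrow> real) \<Rightarrow> (real \<Rightarrow> 'a \<Rightarrow> real) \<Rightarrow> bool" where
  "mbm M H Y \<longleftrightarrow> centered_gaussian_process M Y (mbm_cov H) \<and>
     (AE \<omega> in M. continuous_on {0..} (\<lambda>t. Y t \<omega>))"

definition tagged_partition :: "real \<Rightarrow> nat \<Rightarrow> (nat \<Rightarrow> real) \<Rightarrow> (nat \<Rightarrow> real) \<Rightarrow> bool" where
  "tagged_partition T n p xi \<longleftrightarrow> p 0 = 0 \<and> p n = T \<and>
     (\<forall>i<n. p i < p (Suc i) \<and> p i \<le> xi i \<and> xi i \<le> p (Suc i))"

definition RS_sum :: "(real \<Rightarrow> real) \<Rightarrow> (real \<Rightarrow> real) \<Rightarrow> nat \<Rightarrow> (nat \<Rightarrow> real) \<Rightarrow> (nat \<Rightarrow> real) \<Rightarrow> real" where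
  "RS_sum f g n p xi = (\<Sum>i<n. f (xi i) * (g (p (Suc i)) - g (p i)))"

definition has_RS_integral :: "(real \<Rightarrow> real) \<Rightarrow> (real \<Rightarrow> real) \<Rightarrow> real \<Rightarrow> real \<Rightarrow> bool" where
  "has_RS_integral f g T I \<longleftrightarrow>
     (\<forall>e>0. \<exists>d>0. \<forall>n p xi. tagged_partition T n p xi \<and> (\<forall>i<n. p (Suc i) - p i < d)
        \<longrightarrow> \<bar>RS_sum f g n p xi - I\<bar> < e)"

definition RS_integral :: "(real \<Rightarrow> real) \<Rightarrow> (real \<Rightarrow> real) \<Rightarrow> real \<Rightarrow> real" where
  "RS_integral f g T = (THE I. has_RS_integral f g T I)"

end

(* Since X is Hoelder of order > 1/2, the integral of X dX is (X_T^2 - X_0^2)/2. Variation of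
constants gives X_T exp(-theta T) -> theta L with L = int_0^oo exp(-theta s) (x0 + Y_s) ds, and if
L is nonzero, l'Hopital's rule gives int_0^T X^2 ~ X_T^2 / (2 theta), whence the claim.

Regularity: the spectral representation bounds the variance of Y_t - Y_s by
C (1+s)^2 |t-s|^(2 gamma) for some gamma > 1/2. Gaussian moments of the dyadic increments, summed
over all scales and all of [0,oo) with suitable weights, give Hoelder continuity and polynomial
growth of the paths at once.

L is nonzero almost surely: it is a limit of Gaussian Riemann sums whose variances are bounded
below, because the real parts cos(tu) - 1 of the spectral kernels all have the same sign. *)

theory Submission
  imports Defs "HOL-Real_Asymp.Real_Asymp"
begin

section \<open>Dyadic chaining and Riemann-Stieltjes integrals\<close>

text \<open>\<open>mbm\<close> prescribes covariances and path continuity only, so no stochastic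
  integral occurs. \<open>Y\<close> is accessible through variances of finite linear combinations,
  which are squared L2 norms of combined spectral kernels: upper bounds on them control the paths,
  lower bounds give nondegeneracy. A varying \<open>H\<close> destroys stationarity of the
  increments: moving the time also moves the exponent. The resulting error carries the factor
  exp(isu) - 1, whose low-frequency size grows with s; this is the origin of the weight (1 + s)^2.
  Regularity on compact intervals would not suffice, because the discounted integral runs over a
  half-line; hence one series over all dyadic points instead of Kolmogorov's criterion interval by
  interval. The law of L is never identified. To exclude the value 0 it is enough that the
  approximating sums lie in (-eps, eps) with probability at most a fixed multiple of eps.\<close>

lemma dyadic_floor_approx:
  fixes x :: real
  assumes "0 \<le> x"
  shows "real (nat \<lfloor>x * 2 ^ j\<rfloor>) / 2 ^ j \<le> x" "x < real (nat \<lfloor>x * 2 ^ j\<rfloor>) / 2 ^ j + 1 / 2 ^ j"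
proof -
  have "0 \<le> x * 2 ^ j" using assms by simp
  then have e: "real (nat \<lfloor>x * 2 ^ j\<rfloor>) = of_int \<lfloor>x * 2 ^ j\<rfloor>" by simp
  show "real (nat \<lfloor>x * 2 ^ j\<rfloor>) / 2 ^ j \<le> x"
    unfolding e by (simp add: divide_le_eq)
  have "x * 2 ^ j < of_int \<lfloor>x * 2 ^ j\<rfloor> + 1" by linarith
  then show "x < real (nat \<lfloor>x * 2 ^ j\<rfloor>) / 2 ^ j + 1 / 2 ^ j"
    unfolding e by (simp add: add_divide_distrib[symmetric] less_divide_eq)
qed

lemma nat_floor_double_cases:
  fixes y :: real
  assumes "0 \<le> y"
  shows "nat \<lfloor>2 * y\<rfloor> = 2 * nat \<lfloor>y\<rfloor> \<or> nat \<lfloor>2 * y\<rfloor> = Suc (2 * nat \<lfloor>y\<rfloor>)"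
  using assms by linarith

text \<open>Chaining: passing from level j to level j + 1, the dyadic floor of a point stays or
  moves by one cell, so the distance from f at a point to f at its level-m floor is a geometric
  tail. At the level m with 2^-(m+1) < t - s <= 2^-m the floors of s and t coincide or are
  neighbours.\<close>

lemma Hoelder_of_dyadic_increments:
  fixes f :: "real \<Rightarrow> real" and \<gamma> B N s t :: real
  defines "r \<equiv> 2 powr (- \<gamma>)"
  assumes cont: "continuous_on {0..N} f" and "0 < \<gamma>" "0 \<le> B"
    and inc: "\<And>m k. real (Suc k) / 2 ^ m \<le> N \<Longrightarrow>
                \<bar>f (real (Suc k) / 2 ^ m) - f (real k / 2 ^ m)\<bar> \<le> B * r ^ m"
    and st: "0 \<le> s" "s \<le> t" "t \<le> N" "t - s \<le> 1"
  shows "\<bar>f t - f s\<bar> \<le> B * (2 / (r * (1 - r))) * (t - s) powr \<gamma>"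
proof (cases "s = t")
  case True
  then show ?thesis by simp
next
  case False
  with st have lt: "s < t" by simp
  have r0: "0 < r" and r1: "r < 1"
    using \<open>0 < \<gamma>\<close> by (auto simp: r_def powr_less_one)
  define d where "d j x = real (nat \<lfloor>x * 2 ^ j\<rfloor>) / 2 ^ j" for j :: nat and x :: real
  have d_le: "d j x \<le> x" and d_gt: "x < d j x + 1 / 2 ^ j" and d0: "0 \<le> d j x"
    if "0 \<le> x" for x j
    using dyadic_floor_approx[OF that] by (auto simp: d_def)
  have step: "\<bar>f (d (Suc j) x) - f (d j x)\<bar> \<le> B * r ^ Suc j" if x: "0 \<le> x" "x \<le> N" for x j
  proof -
    define k where "k = nat \<lfloor>x * 2 ^ j\<rfloor>"
    have eq: "x * 2 ^ Suc j = 2 * (x * 2 ^ j)" by simp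
    have dj: "d j x = real (2 * k) / 2 ^ Suc j" by (simp add: d_def k_def)
    have "nat \<lfloor>x * 2 ^ Suc j\<rfloor> = 2 * k \<or> nat \<lfloor>x * 2 ^ Suc j\<rfloor> = Suc (2 * k)"
      unfolding eq k_def using x by (intro nat_floor_double_cases) auto
    then show ?thesis
    proof
      assume "nat \<lfloor>x * 2 ^ Suc j\<rfloor> = 2 * k"
      then have "d (Suc j) x = d j x" unfolding dj by (simp add: d_def)
      then show ?thesis using \<open>0 \<le> B\<close> r0 by simp
    next
      assume *: "nat \<lfloor>x * 2 ^ Suc j\<rfloor> = Suc (2 * k)"
      then have "d (Suc j) x = real (Suc (2 * k)) / 2 ^ Suc j" by (simp only: d_def)
      with inc[of "2 * k" "Suc j"] d_le[OF x(1), of "Suc j"] x(2) show ?thesis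
        unfolding dj by simp
    qed
  qed
  \<comment> \<open>The exact partial geometric sum is kept so that the induction closes;
    \<open>app\<close> replaces it by the full tail.\<close>
  have tele: "\<bar>f (d (m + n) x) - f (d m x)\<bar> \<le> B * r ^ Suc m * (1 - r ^ n) / (1 - r)"
    if x: "0 \<le> x" "x \<le> N" for x m n
  proof (induction n)
    case 0
    then show ?case by simp
  next
    case (Suc n)
    have "\<bar>f (d (m + Suc n) x) - f (d m x)\<bar>
        \<le> \<bar>f (d (Suc (m + n)) x) - f (d (m + n) x)\<bar> + \<bar>f (d (m + n) x) - f (d m x)\<bar>" by simp
    also have "\<dots> \<le> B * r ^ Suc (m + n) + B * r ^ Suc m * (1 - r ^ n) / (1 - r)"
      by (intro add_mono step Suc x)
    also have "\<dots> = B * r ^ Suc m * (1 - r ^ Suc n) / (1 - r)"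
      using r1 by (simp add: field_simps power_add)
    finally show ?case .
  qed
  have lim: "(\<lambda>n. f (d (m + n) x)) \<longlonglongrightarrow> f x" if x: "0 \<le> x" "x \<le> N" for x m
  proof -
    have "(\<lambda>n. d n x) \<longlonglongrightarrow> x"
    proof (rule tendsto_sandwich)
      show "eventually (\<lambda>n. x - 1 / 2 ^ n \<le> d n x) sequentially"
        using d_gt[OF x(1)] by (auto intro!: always_eventually simp: less_imp_le algebra_simps)
      show "eventually (\<lambda>n. d n x \<le> x) sequentially" using d_le[OF x(1)] by simp
      have "(\<lambda>n. x - (1 / 2) ^ n) \<longlonglongrightarrow> x - 0"
        by (intro tendsto_intros LIMSEQ_realpow_zero) auto
      then show "(\<lambda>n. x - 1 / 2 ^ n) \<longlonglongrightarrow> x" by (simp add: power_one_over)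
    qed auto
    then have "(\<lambda>n. f (d n x)) \<longlonglongrightarrow> f x"
      by (rule continuous_on_tendsto_compose[OF cont])
        (use x d_le[OF x(1)] d0[OF x(1)] in \<open>auto intro!: always_eventually intro: order_trans\<close>)
    then show ?thesis using LIMSEQ_ignore_initial_segment[of _ _ m] by (simp add: add.commute)
  qed
  have app: "\<bar>f x - f (d m x)\<bar> \<le> B * r ^ Suc m / (1 - r)" if x: "0 \<le> x" "x \<le> N" for x m
  proof (rule tendsto_upperbound)
    show "(\<lambda>n. \<bar>f (d (m + n) x) - f (d m x)\<bar>) \<longlonglongrightarrow> \<bar>f x - f (d m x)\<bar>"
      by (intro tendsto_intros lim x)
    have "B * r ^ Suc m * (1 - r ^ n) / (1 - r) \<le> B * r ^ Suc m / (1 - r)" for n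
      using r0 r1 \<open>0 \<le> B\<close> by (intro divide_right_mono mult_left_le) auto
    with tele[OF x, of m] show "eventually (\<lambda>n. \<bar>f (d (m + n) x) - f (d m x)\<bar> \<le> B * r ^ Suc m / (1 - r)) sequentially"
      by (auto intro!: always_eventually intro: order_trans)
  qed simp
  have "\<exists>m. (1 / 2 :: real) ^ m < t - s"
    using lt by (intro real_arch_pow_inv) auto
  \<comment> \<open>Minimality yields both sides of the scale: \<open>m'\<close> is positive because
    t - s <= 1, and its predecessor m fails the strict inequality.\<close>
  define m' where "m' = (LEAST m. (1 / 2 :: real) ^ m < t - s)"
  have m': "(1 / 2 :: real) ^ m' < t - s"
    unfolding m'_def by (rule LeastI_ex) fact
  have "m' \<noteq> 0" using m' st(4) by (intro notI) simp
  then obtain m where mm: "m' = Suc m" by (cases m') auto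
  have "\<not> (1 / 2 :: real) ^ m < t - s"
    using not_less_Least[of m "\<lambda>m. (1 / 2 :: real) ^ m < t - s"] mm by (simp add: m'_def)
  then have ub: "t - s \<le> 1 / 2 ^ m" by (simp add: power_one_over)
  have "((1 / 2) ^ Suc m) powr \<gamma> \<le> (t - s) powr \<gamma>"
    using m' mm \<open>0 < \<gamma>\<close> by (intro powr_mono2) auto
  moreover have "((1 / 2) ^ Suc m) powr \<gamma> = r ^ Suc m"
  proof -
    have "((1 / 2 :: real) ^ Suc m) powr \<gamma> = ((1 / 2) powr \<gamma>) ^ Suc m"
      by (subst (1 2) powr_realpow[symmetric]) (auto simp: powr_powr mult.commute)
    also have "(1 / 2 :: real) powr \<gamma> = r" by (simp add: r_def powr_divide powr_minus_divide)
    finally show ?thesis .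
  qed
  ultimately have rm: "r ^ Suc m \<le> (t - s) powr \<gamma>" by simp
  have mid: "\<bar>f (d m t) - f (d m s)\<bar> \<le> B * r ^ m"
  proof -
    define k where "k = nat \<lfloor>s * 2 ^ m\<rfloor>"
    have "t * 2 ^ m \<le> s * 2 ^ m + 1" using ub by (simp add: field_simps)
    moreover have "0 \<le> s * 2 ^ m" "s * 2 ^ m \<le> t * 2 ^ m" using st by auto
    ultimately have "nat \<lfloor>t * 2 ^ m\<rfloor> = k \<or> nat \<lfloor>t * 2 ^ m\<rfloor> = Suc k" unfolding k_def by linarith
    then show ?thesis
    proof
      assume "nat \<lfloor>t * 2 ^ m\<rfloor> = k"
      then show ?thesis using \<open>0 \<le> B\<close> r0 by (simp add: d_def k_def)
    next
      assume "nat \<lfloor>t * 2 ^ m\<rfloor> = Suc k"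
      then have "d m t = real (Suc k) / 2 ^ m" "d m s = real k / 2 ^ m"
        by (simp_all only: d_def k_def)
      with inc[of k m] d_le[of t m] st show ?thesis by auto
    qed
  qed
  have "\<bar>f t - f s\<bar> \<le> \<bar>f t - f (d m t)\<bar> + \<bar>f (d m t) - f (d m s)\<bar> + \<bar>f s - f (d m s)\<bar>" by linarith
  also have "\<dots> \<le> B * r ^ Suc m / (1 - r) + B * r ^ m + B * r ^ Suc m / (1 - r)"
    using app[of t m] app[of s m] st mid by (intro add_mono) auto
  \<comment> \<open>Two tails and one middle step give (1 + r) / (1 - r), which is at most 2 / (1 -
    r); the further 1 / r in the constant pays for passing from \<open>r ^ m\<close> to
    \<open>r ^ Suc m\<close>, the quantity comparable with (t - s)^gamma.\<close>
  also have "\<dots> = B * r ^ m * ((1 + r) / (1 - r))"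
    using r1 by (simp add: divide_simps) (simp add: algebra_simps)
  also have "\<dots> \<le> B * r ^ m * (2 / (1 - r))"
    using r0 r1 \<open>0 \<le> B\<close> by (intro mult_left_mono divide_right_mono) auto
  also have "\<dots> = B * (2 / (r * (1 - r))) * r ^ Suc m"
    using r0 by simp
  also have "\<dots> \<le> B * (2 / (r * (1 - r))) * (t - s) powr \<gamma>"
    using rm r0 r1 \<open>0 \<le> B\<close> by (intro mult_left_mono) auto
  finally show ?thesis .
qed

section \<open>Riemann-Stieltjes sums of a Hoelder path against itself\<close>

lemma tagged_partition_le:
  assumes "tagged_partition T n p xi" "i \<le> j" "j \<le> n"
  shows "p i \<le> p j"
  using assms(2,3)
proof (induction j)
  case 0
  then show ?case by simp
next
  case (Suc j)
  then show ?case
    using assms(1) unfolding tagged_partition_def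
    by (cases "i = Suc j") (auto intro: order_trans[OF _ less_imp_le])
qed

lemma uniform_tagged_partition:
  assumes "0 < T" "0 < n"
  shows "tagged_partition T n (\<lambda>i. T * real i / real n) (\<lambda>i. T * real i / real n)"
  using assms by (auto simp: tagged_partition_def divide_simps)

text \<open>Two candidates are compared on one partition finer than both meshes; for T > 0 the
  uniform partition provides it. This is what makes the \<open>THE\<close> in
  \<open>RS_integral\<close> meaningful.\<close>

lemma has_RS_integral_unique:
  assumes "0 < T" "has_RS_integral f g T I" "has_RS_integral f g T J"
  shows "I = J"
proof (rule ccontr)
  assume "I \<noteq> J"
  define e where "e = \<bar>I - J\<bar> / 2"
  have "e > 0" using \<open>I \<noteq> J\<close> by (simp add: e_def)
  obtain d1 where d1: "d1 > 0" "\<And>n p xi. tagged_partition T n p xi \<Longrightarrow> (\<forall>i<n. p (Suc i) - p i < d1)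
        \<Longrightarrow> \<bar>RS_sum f g n p xi - I\<bar> < e"
    using assms(2) \<open>e > 0\<close> unfolding has_RS_integral_def by metis
  obtain d2 where d2: "d2 > 0" "\<And>n p xi. tagged_partition T n p xi \<Longrightarrow> (\<forall>i<n. p (Suc i) - p i < d2)
        \<Longrightarrow> \<bar>RS_sum f g n p xi - J\<bar> < e"
    using assms(3) \<open>e > 0\<close> unfolding has_RS_integral_def by metis
  obtain n :: nat where n: "T / min d1 d2 < real n" using reals_Archimedean2 by blast
  have "0 < T / min d1 d2" using assms(1) d1(1) d2(1) by simp
  with n have n0: "0 < n" by (cases n) auto
  define p where "p i = T * real i / real n" for i
  have tp: "tagged_partition T n p p"
    unfolding p_def using uniform_tagged_partition[OF assms(1) n0] .
  have "p (Suc i) - p i = T / real n" for i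
    by (simp add: p_def field_simps diff_divide_distrib[symmetric])
  moreover have "T / real n < min d1 d2"
    using n n0 d1(1) d2(1) assms(1) by (simp add: pos_divide_less_eq mult.commute del: min_less_iff_conj)
  ultimately have "\<bar>RS_sum f g n p p - I\<bar> < e" "\<bar>RS_sum f g n p p - J\<bar> < e"
    using d1(2)[OF tp] d2(2)[OF tp] by auto
  then show False
    using abs_triangle_ineq4[of "RS_sum f g n p p - J" "RS_sum f g n p p - I"] unfolding e_def by simp
qed

text \<open>Each summand differs from half the increment of the square by at most the squared
oscillation on its interval, and these sum to a positive power of the mesh.\<close>
lemma has_RS_integral_self_Hoelder:
  fixes X :: "real \<Rightarrow> real"
  assumes "0 < T" "1/2 < \<gamma>" "0 \<le> C"
    and hol: "\<And>s t. 0 \<le> s \<Longrightarrow> s \<le> t \<Longrightarrow> t \<le> T \<Longrightarrow> t - s \<le> 1 \<Longrightarrow> \<bar>X t - X s\<bar> \<le> C * (t - s) powr \<gamma>"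
  shows "has_RS_integral X X T (((X T)\<^sup>2 - (X 0)\<^sup>2) / 2)"
  unfolding has_RS_integral_def
proof (intro allI impI)
  fix e :: real assume "e > 0"
  define a where "a = 2 * \<gamma> - 1"
  have "a > 0" using assms by (simp add: a_def)
  define K where "K = C\<^sup>2 * T + 1"
  have "K > 0" using assms by (simp add: K_def add_nonneg_pos)
  \<comment> \<open>The power makes \<open>K * d powr a\<close> at most e / 2. The cap 1 is there
    because the Hoelder bound covers only distances up to 1, and the summand 1 in \<open>K\<close>
    keeps it positive when C = 0.\<close>
  define d where "d = min 1 ((e / (2 * K)) powr (1 / a))"
  have "d > 0" using \<open>e > 0\<close> \<open>K > 0\<close> by (simp add: d_def)
  show "\<exists>d>0. \<forall>n p xi. tagged_partition T n p xi \<and> (\<forall>i<n. p (Suc i) - p i < d)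
        \<longrightarrow> \<bar>RS_sum X X n p xi - ((X T)\<^sup>2 - (X 0)\<^sup>2) / 2\<bar> < e"
  proof (intro exI[of _ d] conjI allI impI, fact, elim conjE)
    fix n p xi assume tp: "tagged_partition T n p xi" and mesh: "\<forall>i<n. p (Suc i) - p i < d"
    have p0: "p 0 = 0" and pn: "p n = T" and pt: "\<And>i. i < n \<Longrightarrow> p i < p (Suc i) \<and> p i \<le> xi i \<and> xi i \<le> p (Suc i)"
      using tp by (auto simp: tagged_partition_def)
    have dpow: "d powr a \<le> e / (2 * K)"
    proof -
      have "d powr a \<le> ((e / (2 * K)) powr (1 / a)) powr a"
        using \<open>d > 0\<close> \<open>a > 0\<close> by (intro powr_mono2) (auto simp: d_def)
      also have "\<dots> = e / (2 * K)" using \<open>a > 0\<close> \<open>e > 0\<close> \<open>K > 0\<close> by (simp add: powr_powr)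
      finally show ?thesis .
    qed
    have summand: "\<bar>X (xi i) * (X (p (Suc i)) - X (p i)) - ((X (p (Suc i)))\<^sup>2 - (X (p i))\<^sup>2) / 2\<bar>
        \<le> C\<^sup>2 * d powr a * (p (Suc i) - p i)" if i: "i < n" for i
    proof -
      let ?h = "p (Suc i) - p i"
      have h: "0 < ?h" "?h < d" "?h \<le> 1" using pt[OF i] mesh i by (auto simp: d_def intro: less_imp_le less_le_trans)
      have pos: "0 \<le> p i" "p (Suc i) \<le> T"
        using tagged_partition_le[OF tp, of 0 i] tagged_partition_le[OF tp, of "Suc i" n] i p0 pn by auto
      have b: "\<bar>X v - X u\<bar> \<le> C * ?h powr \<gamma>" if "p i \<le> u" "u \<le> v" "v \<le> p (Suc i)" for u v
      proof -
        have "\<bar>X v - X u\<bar> \<le> C * (v - u) powr \<gamma>" using that pos h by (intro hol) auto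
        also have "\<dots> \<le> C * ?h powr \<gamma>" using that assms by (intro mult_left_mono powr_mono2) auto
        finally show ?thesis .
      qed
      have b1: "\<bar>X (p (Suc i)) - X (p i)\<bar> \<le> C * ?h powr \<gamma>"
        and b2: "\<bar>X (xi i) - X (p i)\<bar> \<le> C * ?h powr \<gamma>"
        and b3: "\<bar>X (p (Suc i)) - X (xi i)\<bar> \<le> C * ?h powr \<gamma>"
        using pt[OF i] by (auto intro!: b)
      \<comment> \<open>The tagged value minus the mean of the endpoint values is half the
        difference of the two partial increments, so the error is a product of two increments: order
        2 gamma > 1 in the cell length.\<close>
      have "X (xi i) * (X (p (Suc i)) - X (p i)) - ((X (p (Suc i)))\<^sup>2 - (X (p i))\<^sup>2) / 2
        = ((X (xi i) - X (p i)) - (X (p (Suc i)) - X (xi i))) / 2 * (X (p (Suc i)) - X (p i))"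
        by (simp add: power2_eq_square field_simps)
      also have "\<bar>\<dots>\<bar> \<le> (C * ?h powr \<gamma>) * (C * ?h powr \<gamma>)"
      proof -
        have "\<bar>((X (xi i) - X (p i)) - (X (p (Suc i)) - X (xi i))) / 2\<bar> \<le> C * ?h powr \<gamma>"
          using b2 b3 abs_triangle_ineq4[of "X (xi i) - X (p i)" "X (p (Suc i)) - X (xi i)"]
          unfolding abs_divide by simp
        then show ?thesis unfolding abs_mult using b1 \<open>0 \<le> C\<close> by (intro mult_mono) auto
      qed
      also have "\<dots> = C\<^sup>2 * (?h powr (a + 1))"
        using h by (simp add: power2_eq_square a_def powr_add[symmetric])
      also have "\<dots> = C\<^sup>2 * (?h powr a * ?h)" using h by (simp only: powr_add powr_one)
      also have "\<dots> \<le> C\<^sup>2 * (d powr a * ?h)"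
        using h \<open>a > 0\<close> by (intro mult_left_mono mult_right_mono powr_mono2) auto
      finally show ?thesis by (simp add: mult.assoc)
    qed
    have tel: "(\<Sum>i<n. ((X (p (Suc i)))\<^sup>2 - (X (p i))\<^sup>2) / 2) = ((X T)\<^sup>2 - (X 0)\<^sup>2) / 2"
      unfolding sum_divide_distrib[symmetric] sum_lessThan_telescope[of "\<lambda>i. (X (p i))\<^sup>2"] by (simp add: p0 pn)
    have "\<bar>RS_sum X X n p xi - ((X T)\<^sup>2 - (X 0)\<^sup>2) / 2\<bar>
      = \<bar>\<Sum>i<n. X (xi i) * (X (p (Suc i)) - X (p i)) - ((X (p (Suc i)))\<^sup>2 - (X (p i))\<^sup>2) / 2\<bar>"
      unfolding tel[symmetric] RS_sum_def by (simp add: sum_subtractf)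
    also have "\<dots> \<le> (\<Sum>i<n. C\<^sup>2 * d powr a * (p (Suc i) - p i))"
      by (rule order_trans[OF sum_abs]) (intro sum_mono summand, auto)
    also have "\<dots> = C\<^sup>2 * d powr a * T"
      unfolding sum_distrib_left[symmetric] sum_lessThan_telescope by (simp add: p0 pn)
    also have "\<dots> \<le> K * d powr a" by (simp add: K_def algebra_simps)
    also have "\<dots> \<le> K * (e / (2 * K))" using dpow \<open>K > 0\<close> by (intro mult_left_mono) auto
    also have "\<dots> < e" using \<open>K > 0\<close> \<open>e > 0\<close> by simp
    finally show "\<bar>RS_sum X X n p xi - ((X T)\<^sup>2 - (X 0)\<^sup>2) / 2\<bar> < e" .
  qed
qed

lemma RS_integral_self_Hoelder:
  fixes X :: "real \<Rightarrow> real"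
  assumes "0 < T" "1/2 < \<gamma>" "0 \<le> C"
    and "\<And>s t. 0 \<le> s \<Longrightarrow> s \<le> t \<Longrightarrow> t \<le> T \<Longrightarrow> t - s \<le> 1 \<Longrightarrow> \<bar>X t - X s\<bar> \<le> C * (t - s) powr \<gamma>"
  shows "RS_integral X X T = ((X T)\<^sup>2 - (X 0)\<^sup>2) / 2"
  unfolding RS_integral_def
proof (rule the_equality)
  show *: "has_RS_integral X X T (((X T)\<^sup>2 - (X 0)\<^sup>2) / 2)"
    using assms by (rule has_RS_integral_self_Hoelder)
  show "I = ((X T)\<^sup>2 - (X 0)\<^sup>2) / 2" if "has_RS_integral X X T I" for I
    using has_RS_integral_unique[OF assms(1) that *] .
qed

section \<open>Pathwise analysis of the linear equation\<close>

text \<open>Growth at half the discount rate leaves the factor exp(-theta s / 2), an integrable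
  majorant on the half-line. The limit is therefore a Lebesgue integral, approached by its
  truncations.\<close>

lemma discounted_integral_tendsto:
  fixes Y :: "real \<Rightarrow> real" and \<theta> K x0 :: real
  assumes cont: "continuous_on {0..} Y" and "0 < \<theta>"
    and growth: "\<And>t. 0 \<le> t \<Longrightarrow> \<bar>Y t\<bar> \<le> K * exp (\<theta> / 2 * t)"
  shows "\<exists>L. ((\<lambda>T. integral {0..T} (\<lambda>s. exp (- \<theta> * s) * (x0 + Y s))) \<longlongrightarrow> L) at_top"
proof -
  define g where "g s = exp (- \<theta> * s) * (x0 + Y s)" for s
  have contg: "continuous_on {0..} g"
    unfolding g_def by (intro continuous_intros cont)
  define f where "f s = indicator {0..} s *\<^sub>R g s" for s
  have [measurable]: "f \<in> borel_measurable borel"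
    unfolding f_def by (rule borel_measurable_continuous_on_indicator[OF _ contg]) simp
  define b where "b s = (\<bar>x0\<bar> + \<bar>K\<bar>) * (indicator {0..} s * exp (- (\<theta> / 2) * s))" for s :: real
  have "(\<lambda>x. exp (- (\<theta> / 2) * x)) integrable_on {0..}"
    using integrable_on_exp_minus_to_infinity[of "\<theta> / 2" 0] assms by simp
  then have "(\<lambda>x. exp (- (\<theta> / 2) * x)) absolutely_integrable_on {0..}"
    by (intro nonnegative_absolutely_integrable_1) auto
  then have "integrable lebesgue (\<lambda>s. indicator {0..} s *\<^sub>R exp (- (\<theta> / 2) * s))"
    by (simp add: set_integrable_def)
  then have "integrable lborel (\<lambda>s. indicator {0..} s * exp (- (\<theta> / 2) * s))"
    by (subst (asm) integrable_completion) auto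
  then have b: "integrable lborel b" unfolding b_def by (rule integrable_mult_right)
  have "integrable lborel f"
  proof (rule Bochner_Integration.integrable_bound[OF b])
    show "AE s in lborel. norm (f s) \<le> norm (b s)"
    proof (rule AE_I2)
      fix s
      show "norm (f s) \<le> norm (b s)"
      proof (cases "0 \<le> s")
        case True
        have e: "1 \<le> exp (\<theta> / 2 * s)" using True \<open>0 < \<theta>\<close> by simp
        have "\<bar>x0 + Y s\<bar> \<le> \<bar>x0\<bar> * 1 + \<bar>K\<bar> * exp (\<theta> / 2 * s)"
          using growth[OF True] abs_triangle_ineq[of x0 "Y s"] mult_right_mono[OF abs_ge_self[of K] exp_ge_zero[of "\<theta> / 2 * s"]] by linarith
        also have "\<dots> \<le> \<bar>x0\<bar> * exp (\<theta> / 2 * s) + \<bar>K\<bar> * exp (\<theta> / 2 * s)"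
          using e by (intro add_mono mult_left_mono) auto
        finally have "exp (- \<theta> * s) * \<bar>x0 + Y s\<bar> \<le> exp (- \<theta> * s) * ((\<bar>x0\<bar> + \<bar>K\<bar>) * exp (\<theta> / 2 * s))"
          by (intro mult_left_mono) (auto simp: algebra_simps)
        also have "\<dots> = (\<bar>x0\<bar> + \<bar>K\<bar>) * exp (- (\<theta> / 2) * s)"
          by (simp add: exp_add[symmetric] algebra_simps)
        finally show ?thesis using True by (simp add: f_def g_def b_def abs_mult)
      qed (simp add: f_def b_def)
    qed
  qed simp
  then have "((\<lambda>y. \<integral>x. indicator {..y} x *\<^sub>R f x \<partial>lborel) \<longlongrightarrow> (\<integral>x. f x \<partial>lborel)) at_top"
    by (intro tendsto_integral_at_top) auto
  moreover have "(\<integral>x. indicator {..T} x *\<^sub>R f x \<partial>lborel) = integral {0..T} g" for T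
  proof -
    have "(\<integral>x. indicator {..T} x *\<^sub>R f x \<partial>lborel) = (LINT x:{0..T}|lborel. g x)"
      unfolding set_lebesgue_integral_def f_def
      by (intro Bochner_Integration.integral_cong) (auto simp: indicator_def)
    also have "\<dots> = integral {0..T} g"
      by (rule set_borel_integral_eq_integral(2))
        (rule borel_integrable_atLeastAtMost', rule continuous_on_subset[OF contg], auto)
    finally show ?thesis .
  qed
  ultimately show ?thesis unfolding g_def by auto
qed

text \<open>With \<open>Z T = \<integral>\<^bsub>0\<^esub>\<^bsup>T\<^esup> X\<close> the equation reads \<open>(e\<^bsup>-\<theta>T\<^esup> Z)' = e\<^bsup>-\<theta>T\<^esup> (x0 + Y)\<close>.\<close>
lemma discounted_solution_tendsto:
  fixes X Y :: "real \<Rightarrow> real" and \<theta> K x0 :: real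
  assumes contX: "continuous_on {0..} X" and "0 < \<theta>"
    and eq: "\<And>t. 0 \<le> t \<Longrightarrow> X t = x0 + \<theta> * integral {0..t} X + Y t"
    and growth: "\<And>t. 0 \<le> t \<Longrightarrow> \<bar>Y t\<bar> \<le> K * exp (\<theta> / 2 * t)"
    and L: "((\<lambda>T. integral {0..T} (\<lambda>s. exp (- \<theta> * s) * (x0 + Y s))) \<longlongrightarrow> L) at_top"
  shows "((\<lambda>T. X T * exp (- \<theta> * T)) \<longlongrightarrow> \<theta> * L) at_top"
proof -
  define Z where "Z t = integral {0..t} X" for t
  have Zeq: "exp (- \<theta> * T) * Z T = integral {0..T} (\<lambda>s. exp (- \<theta> * s) * (x0 + Y s))" if "0 \<le> T" for T
  proof -
    have "((\<lambda>s. exp (- \<theta> * s) * (x0 + Y s)) has_integral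
        (exp (- \<theta> * T) * Z T - exp (- \<theta> * 0) * Z 0)) {0..T}"
    proof (rule fundamental_theorem_of_calculus[OF that])
      fix t assume t: "t \<in> {0..T}"
      have "(Z has_real_derivative X t) (at t within {0..T})"
        unfolding Z_def by (rule integral_has_real_derivative[OF _ t])
          (rule continuous_on_subset[OF contX], auto)
      then have "((\<lambda>t. exp (- \<theta> * t) * Z t) has_real_derivative
          exp (- \<theta> * t) * X t + (exp (- \<theta> * t) * (- \<theta>)) * Z t) (at t within {0..T})"
        by (auto intro!: derivative_eq_intros)
      also have "exp (- \<theta> * t) * X t + (exp (- \<theta> * t) * (- \<theta>)) * Z t = exp (- \<theta> * t) * (x0 + Y t)"
        using eq[of t] t by (simp add: Z_def algebra_simps)
      finally show "((\<lambda>t. exp (- \<theta> * t) * Z t) has_vector_derivative exp (- \<theta> * t) * (x0 + Y t)) (at t within {0..T})"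
        by (simp add: has_real_derivative_iff_has_vector_derivative)
    qed
    then show ?thesis by (simp add: Z_def integral_unique)
  qed
  \<comment> \<open>The equation multiplied by the discount factor; the two outer terms vanish as T
    grows.\<close>
  have decomp: "X T * exp (- \<theta> * T) = x0 * exp (- \<theta> * T)
      + \<theta> * integral {0..T} (\<lambda>s. exp (- \<theta> * s) * (x0 + Y s)) + Y T * exp (- \<theta> * T)" if "0 \<le> T" for T
    unfolding Zeq[OF that, symmetric] using eq[OF that] by (simp add: Z_def algebra_simps)
  have e1: "((\<lambda>T. exp (- \<theta> * T)) \<longlongrightarrow> 0) at_top" if "0 < \<theta>" for \<theta> :: real
    using that by real_asymp
  have "((\<lambda>T. Y T * exp (- \<theta> * T)) \<longlongrightarrow> 0) at_top"
  proof (rule Lim_null_comparison)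
    show "eventually (\<lambda>T. norm (Y T * exp (- \<theta> * T)) \<le> K * exp (- (\<theta> / 2) * T)) at_top"
      using eventually_ge_at_top[of 0]
    proof eventually_elim
      case (elim T)
      have "norm (Y T * exp (- \<theta> * T)) \<le> (K * exp (\<theta> / 2 * T)) * exp (- \<theta> * T)"
        using growth[OF elim] by (simp add: abs_mult)
      also have "\<dots> = K * exp (- (\<theta> / 2) * T)" by (simp add: exp_add[symmetric] algebra_simps)
      finally show ?case .
    qed
    show "((\<lambda>T. K * exp (- (\<theta> / 2) * T)) \<longlongrightarrow> 0) at_top"
      using e1[of "\<theta> / 2"] \<open>0 < \<theta>\<close> by (intro tendsto_mult_right_zero) auto
  qed
  then have "((\<lambda>T. x0 * exp (- \<theta> * T) + \<theta> * integral {0..T} (\<lambda>s. exp (- \<theta> * s) * (x0 + Y s))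
      + Y T * exp (- \<theta> * T)) \<longlongrightarrow> x0 * 0 + \<theta> * L + 0) at_top"
    by (intro tendsto_intros L e1 \<open>0 < \<theta>\<close>)
  then show ?thesis
    unfolding mult_zero_right add_0_left add_0_right
    by (rule Lim_transform_eventually)
      (intro eventually_mono[OF eventually_ge_at_top[of 0]] decomp[symmetric])
qed

text \<open>After division by exp(2 theta T) the numerator tends to xi^2 / 2 and the denominator to
  xi^2 / (2 theta); xi being nonzero lets the quotient of the limits be taken.\<close>

lemma quotient_tendsto_of_exponential_growth:
  fixes X :: "real \<Rightarrow> real" and \<theta> \<xi> :: real
  assumes contX: "continuous_on {0..} X" and "0 < \<theta>" "\<xi> \<noteq> 0"
    and lim: "((\<lambda>T. X T * exp (- \<theta> * T)) \<longlongrightarrow> \<xi>) at_top"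
  shows "((\<lambda>T. (((X T)\<^sup>2 - (X 0)\<^sup>2) / 2) / integral {0..T} (\<lambda>s. (X s)\<^sup>2)) \<longlongrightarrow> \<theta>) at_top"
proof -
  define I where "I T = integral {0..T} (\<lambda>s. (X s)\<^sup>2)" for T
  have sq: "((\<lambda>T. (X T)\<^sup>2 * exp (- (2 * \<theta> * T))) \<longlongrightarrow> \<xi>\<^sup>2) at_top"
    using tendsto_power[OF lim, of 2]
    by (simp add: power_mult_distrib exp_double[symmetric] mult.assoc[symmetric])
  have "((\<lambda>T. I T / exp (2 * \<theta> * T)) \<longlongrightarrow> \<xi>\<^sup>2 / (2 * \<theta>)) at_top"
  \<comment> \<open>This form of the rule asks for divergence of exp(2 theta T) alone; about
    \<open>I\<close> only its derivative enters.\<close>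
  proof (rule lhospital_at_top_at_top)
    show "LIM T at_top. exp (2 * \<theta> * T) :> at_top" using \<open>0 < \<theta>\<close> by real_asymp
    show "eventually (\<lambda>T. exp (2 * \<theta> * T) * (2 * \<theta>) \<noteq> 0) at_top" using \<open>0 < \<theta>\<close> by simp
    show "eventually (\<lambda>T. (I has_real_derivative (X T)\<^sup>2) (at T)) at_top"
      using eventually_gt_at_top[of 0]
    proof eventually_elim
      case (elim T)
      have "(I has_real_derivative (X T)\<^sup>2) (at T within {0..T + 1})"
        unfolding I_def by (rule integral_has_real_derivative)
          (use elim in \<open>auto intro!: continuous_intros continuous_on_subset[OF contX]\<close>)
      moreover have "at T within {0..T + 1} = at T"
        using elim by (intro at_within_interior) simp
      ultimately show ?case by simp
    qed
    show "eventually (\<lambda>T. ((\<lambda>T. exp (2 * \<theta> * T)) has_real_derivative exp (2 * \<theta> * T) * (2 * \<theta>)) (at T)) at_top"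
      by (auto intro!: always_eventually derivative_eq_intros)
    have "((\<lambda>T. ((X T)\<^sup>2 * exp (- (2 * \<theta> * T))) / (2 * \<theta>)) \<longlongrightarrow> \<xi>\<^sup>2 / (2 * \<theta>)) at_top"
      using \<open>0 < \<theta>\<close> by (intro tendsto_divide sq tendsto_const) auto
    then show "((\<lambda>T. (X T)\<^sup>2 / (exp (2 * \<theta> * T) * (2 * \<theta>))) \<longlongrightarrow> \<xi>\<^sup>2 / (2 * \<theta>)) at_top"
      by (simp add: exp_minus field_simps)
  qed
  moreover have "((\<lambda>T. ((X T)\<^sup>2 * exp (- (2 * \<theta> * T)) - (X 0)\<^sup>2 * exp (- (2 * \<theta> * T))) / 2) \<longlongrightarrow> (\<xi>\<^sup>2 - (X 0)\<^sup>2 * 0) / 2) at_top"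
  proof (intro tendsto_intros sq)
    show "((\<lambda>T. exp (- (2 * \<theta> * T))) \<longlongrightarrow> 0) at_top" using \<open>0 < \<theta>\<close> by real_asymp
  qed simp
  ultimately have "((\<lambda>T. ((X T)\<^sup>2 * exp (- (2 * \<theta> * T)) - (X 0)\<^sup>2 * exp (- (2 * \<theta> * T))) / 2 / (I T / exp (2 * \<theta> * T)))
      \<longlongrightarrow> (\<xi>\<^sup>2 - (X 0)\<^sup>2 * 0) / 2 / (\<xi>\<^sup>2 / (2 * \<theta>))) at_top"
    by (intro tendsto_divide[of _ _ _ "\<lambda>T. I T / exp (2 * \<theta> * T)"])
      (use \<open>\<xi> \<noteq> 0\<close> \<open>0 < \<theta>\<close> in simp_all)
  also have "(\<xi>\<^sup>2 - (X 0)\<^sup>2 * 0) / 2 / (\<xi>\<^sup>2 / (2 * \<theta>)) = \<theta>" using \<open>\<xi> \<noteq> 0\<close> by simp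
  also have "(\<lambda>T. ((X T)\<^sup>2 * exp (- (2 * \<theta> * T)) - (X 0)\<^sup>2 * exp (- (2 * \<theta> * T))) / 2 / (I T / exp (2 * \<theta> * T)))
     = (\<lambda>T. (((X T)\<^sup>2 - (X 0)\<^sup>2) / 2) / I T)"
    by (simp add: fun_eq_iff exp_minus left_diff_distrib[symmetric])
  finally show ?thesis unfolding I_def .
qed

text \<open>The drift is Lipschitz on compact intervals because \<open>X\<close> is bounded there,
  and for t - s <= 1 a Lipschitz bound is also a Hoelder bound of order gamma <= 1. So
  \<open>X\<close> inherits the order of \<open>Y\<close>.\<close>

lemma Hoelder_solution:
  fixes X Y :: "real \<Rightarrow> real"
  assumes contX: "continuous_on {0..} X" and "0 \<le> T" "\<gamma> \<le> 1"
    and eq: "\<And>t. 0 \<le> t \<Longrightarrow> X t = x0 + \<theta> * integral {0..t} X + Y t"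
    and hol: "\<And>s t. 0 \<le> s \<Longrightarrow> s \<le> t \<Longrightarrow> t \<le> T \<Longrightarrow> t - s \<le> 1 \<Longrightarrow> \<bar>Y t - Y s\<bar> \<le> C * (t - s) powr \<gamma>"
  shows "\<exists>C'\<ge>0. \<forall>s t. 0 \<le> s \<longrightarrow> s \<le> t \<longrightarrow> t \<le> T \<longrightarrow> t - s \<le> 1 \<longrightarrow> \<bar>X t - X s\<bar> \<le> C' * (t - s) powr \<gamma>"
proof -
  have "compact (X ` {0..T})"
    by (intro compact_continuous_image continuous_on_subset[OF contX]) auto
  then obtain B where B: "\<And>t. t \<in> {0..T} \<Longrightarrow> \<bar>X t\<bar> \<le> B"
    using compact_imp_bounded bounded_iff by (metis imageI real_norm_def)
  have "0 \<le> B" using B[of 0] \<open>0 \<le> T\<close> by force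
  have "\<bar>X t - X s\<bar> \<le> (\<bar>\<theta>\<bar> * B + \<bar>C\<bar>) * (t - s) powr \<gamma>"
    if st: "0 \<le> s" "s \<le> t" "t \<le> T" "t - s \<le> 1" for s t
  proof -
    have int: "X integrable_on {a..b}" if "0 \<le> a" for a b
      by (intro integrable_continuous_interval continuous_on_subset[OF contX]) (use that in auto)
    have "integral {0..s} X + integral {s..t} X = integral {0..t} X"
      by (rule Henstock_Kurzweil_Integration.integral_combine) (use st in \<open>auto intro: int\<close>)
    then have d: "X t - X s = \<theta> * integral {s..t} X + (Y t - Y s)"
      using eq[of t] eq[of s] st by (simp add: algebra_simps flip: distrib_left)
    have "norm (integral {s..t} X) \<le> B * (t - s)"
      by (rule integral_bound) (use st in \<open>auto intro: B continuous_on_subset[OF contX]\<close>)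
    also have "\<dots> \<le> B * (t - s) powr \<gamma>"
      using st \<open>0 \<le> B\<close> \<open>\<gamma> \<le> 1\<close> powr_mono'[of \<gamma> 1 "t - s"] by (intro mult_left_mono) (auto)
    finally have "\<bar>\<theta>\<bar> * \<bar>integral {s..t} X\<bar> \<le> \<bar>\<theta>\<bar> * (B * (t - s) powr \<gamma>)"
      by (intro mult_left_mono) auto
    moreover have "\<bar>Y t - Y s\<bar> \<le> \<bar>C\<bar> * (t - s) powr \<gamma>"
      using hol[OF st] mult_right_mono[OF abs_ge_self[of C] powr_ge_zero[of "t - s" \<gamma>]] by linarith
    ultimately show ?thesis unfolding d
      using abs_triangle_ineq[of "\<theta> * integral {s..t} X" "Y t - Y s"] by (simp add: abs_mult algebra_simps)
  qed
  then show ?thesis using \<open>0 \<le> B\<close> by (intro exI[of _ "\<bar>\<theta>\<bar> * B + \<bar>C\<bar>"]) auto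
qed

text \<open>The deterministic half of the theorem. What probability must supply for almost every
  path is the growth bound, the local Hoelder bound, and a nonzero L.\<close>

lemma estimator_tendsto_pathwise:
  fixes X Y :: "real \<Rightarrow> real" and \<theta> K x0 L \<gamma> :: real
  assumes contX: "continuous_on {0..} X" and "0 < \<theta>" "1/2 < \<gamma>" "\<gamma> \<le> 1"
    and eq: "\<And>t. 0 \<le> t \<Longrightarrow> X t = x0 + \<theta> * integral {0..t} X + Y t"
    and growth: "\<And>t. 0 \<le> t \<Longrightarrow> \<bar>Y t\<bar> \<le> K * exp (\<theta> / 2 * t)"
    and hol: "\<And>T. 0 \<le> T \<Longrightarrow> \<exists>C. \<forall>s t. 0 \<le> s \<longrightarrow> s \<le> t \<longrightarrow> t \<le> T \<longrightarrow> t - s \<le> 1 \<longrightarrow> \<bar>Y t - Y s\<bar> \<le> C * (t - s) powr \<gamma>"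
    and L: "((\<lambda>T. integral {0..T} (\<lambda>s. exp (- \<theta> * s) * (x0 + Y s))) \<longlongrightarrow> L) at_top" "L \<noteq> 0"
  shows "((\<lambda>T. RS_integral X X T / integral {0..T} (\<lambda>s. (X s)\<^sup>2)) \<longlongrightarrow> \<theta>) at_top"
proof -
  have RS: "RS_integral X X T = ((X T)\<^sup>2 - (X 0)\<^sup>2) / 2" if T: "0 < T" for T
  proof -
    obtain C where "\<forall>s t. 0 \<le> s \<longrightarrow> s \<le> t \<longrightarrow> t \<le> T \<longrightarrow> t - s \<le> 1 \<longrightarrow> \<bar>Y t - Y s\<bar> \<le> C * (t - s) powr \<gamma>"
      using hol T by (metis less_imp_le)
    then obtain C' where "C' \<ge> 0"
      "\<And>s t. 0 \<le> s \<Longrightarrow> s \<le> t \<Longrightarrow> t \<le> T \<Longrightarrow> t - s \<le> 1 \<Longrightarrow> \<bar>X t - X s\<bar> \<le> C' * (t - s) powr \<gamma>"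
      using Hoelder_solution[OF contX less_imp_le[OF T] \<open>\<gamma> \<le> 1\<close> eq, of C] by auto
    then show ?thesis using T \<open>1/2 < \<gamma>\<close> by (intro RS_integral_self_Hoelder) auto
  qed
  have "((\<lambda>T. (((X T)\<^sup>2 - (X 0)\<^sup>2) / 2) / integral {0..T} (\<lambda>s. (X s)\<^sup>2)) \<longlongrightarrow> \<theta>) at_top"
    using discounted_solution_tendsto[OF contX \<open>0 < \<theta>\<close> eq growth L(1)] \<open>0 < \<theta>\<close> L(2)
    by (intro quotient_tendsto_of_exponential_growth[OF contX \<open>0 < \<theta>\<close>, of "\<theta> * L"]) auto
  then show ?thesis
    by (rule Lim_transform_eventually)
      (auto intro!: eventually_mono[OF eventually_gt_at_top[of 0]] simp: RS)
qed

section \<open>Spectral form of the covariance\<close>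

text \<open>Up to a constant, an envelope of the spectral density |exp(iu) - 1|^2 / |u|^(2h+1) of
  fractional Brownian motion with Hurst index h at time 1. All later bounds are expressed in this
  one family.\<close>

definition spectral_majorant :: "real \<Rightarrow> real \<Rightarrow> real" where
  "spectral_majorant h u = min 1 (u\<^sup>2) * \<bar>u\<bar> powr (- 2 * h - 1)"

lemma spectral_majorant_nonneg: "0 \<le> spectral_majorant h u"
  by (simp add: spectral_majorant_def)

lemma integrable_indicator_nonneg_lborel:
  fixes f :: "real \<Rightarrow> real"
  assumes "f integrable_on A" "\<And>x. x \<in> A \<Longrightarrow> 0 \<le> f x" "A \<in> sets borel" "f \<in> borel_measurable borel"
  shows "integrable lborel (\<lambda>x. indicator A x * f x)"
proof -
  have "f absolutely_integrable_on A"
    using assms by (intro nonnegative_absolutely_integrable_1) auto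
  then have "integrable lebesgue (\<lambda>x. indicator A x * f x)"
    by (simp add: set_integrable_def)
  then show ?thesis
    by (subst (asm) integrable_completion) (use assms in auto)
qed

text \<open>Near 0 the majorant is |u|^(1-2h), integrable since h < 1; near infinity it is
  |u|^(-2h-1), integrable since h > 0. \<open>S\<close> dominates it on the positive half-line and
  is then reflected.\<close>

lemma integrable_spectral_majorant:
  assumes "0 < h" "h < 1"
  shows "integrable lborel (spectral_majorant h)"
proof -
  define S where "S u = indicator {0..1} u * u powr (1 - 2 * h) + indicator {1..} u * u powr (- 2 * h - 1)" for u :: real
  have "integrable lborel S"
    unfolding S_def
    using assms
    by (intro Bochner_Integration.integrable_add integrable_indicator_nonneg_lborel
        integrable_on_powr_from_0 has_integral_integrable[OF has_integral_powr_to_inf]) auto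
  moreover from lborel_integrable_real_affine[OF this, of "-1" 0] have "integrable lborel (\<lambda>u. S (- u))"
    by simp
  ultimately have int: "integrable lborel (\<lambda>u. S u + S (- u))" by simp
  have pos: "0 \<le> S u" for u by (simp add: S_def)
  have half: "spectral_majorant h u \<le> S u" if "0 \<le> u" for u
  proof (cases "u \<le> 1")
    case True
    show ?thesis
    proof (cases "u = 0")
      case False
      with that have "u > 0" by simp
      have "u\<^sup>2 * u powr (- 2 * h - 1) = u powr (1 - 2 * h)"
        using \<open>u > 0\<close> powr_add[of u 2 "- 2 * h - 1"] by simp
      moreover have "min 1 (u\<^sup>2) \<le> u\<^sup>2" by simp
      ultimately have "spectral_majorant h u \<le> u powr (1 - 2 * h)"
        using \<open>u > 0\<close> unfolding spectral_majorant_def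
        by (metis abs_of_pos mult_right_mono powr_ge_zero)
      then show ?thesis using True that by (auto simp: S_def indicator_def)
    qed (simp add: spectral_majorant_def S_def)
  next
    case False
    have "spectral_majorant h u \<le> 1 * \<bar>u\<bar> powr (- 2 * h - 1)"
      unfolding spectral_majorant_def by (intro mult_right_mono) auto
    then show ?thesis using False that by (simp add: S_def)
  qed
  have "spectral_majorant h u \<le> S u + S (- u)" for u
  proof (cases "0 \<le> u")
    case True
    then show ?thesis using half[OF True] pos[of "- u"] by linarith
  next
    case False
    then have "spectral_majorant h (- u) \<le> S (- u)" by (intro half) simp
    then show ?thesis using pos[of u] by (simp add: spectral_majorant_def)
  qed
  then show ?thesis
    by (intro Bochner_Integration.integrable_bound[OF int])
      (auto intro!: AE_I2 simp: spectral_majorant_nonneg spectral_majorant_def[abs_def] pos)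
qed

text \<open>The left side is |exp(ix) - 1|^2 = 4 sin(x/2)^2.\<close>

lemma two_minus_two_cos_le: "2 - 2 * cos x \<le> min 4 (x\<^sup>2)" for x :: real
proof -
  have "(sin (x / 2))\<^sup>2 \<le> (x / 2)\<^sup>2"
    using abs_sin_x_le_abs_x[of "x / 2"] by (simp only: abs_le_square_iff)
  moreover have "cos x = 1 - 2 * (sin (x / 2))\<^sup>2"
    using cos_double_sin[of "x / 2"] by simp
  ultimately show ?thesis using cos_ge_minus_one[of x] by (simp add: power2_eq_square)
qed

text \<open>The dependence on t is moved into a constant: t^2 serves the frequencies below 1, and 4
  those above.\<close>

lemma two_minus_two_cos_le_scaled:
  "2 - 2 * cos (t * u) \<le> (4 + t\<^sup>2) * min 1 (u\<^sup>2)" for t u :: real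
proof (cases "u\<^sup>2 \<le> 1")
  case True
  have "2 - 2 * cos (t * u) \<le> t\<^sup>2 * u\<^sup>2"
    using two_minus_two_cos_le[of "t * u"] by (simp add: power_mult_distrib)
  also have "\<dots> \<le> (4 + t\<^sup>2) * u\<^sup>2" by (intro mult_right_mono) auto
  finally show ?thesis using True by (simp add: min_absorb2)
next
  case False
  then have "min 1 (u\<^sup>2) = 1" by simp
  then show ?thesis using cos_ge_minus_one[of "t * u"] zero_le_power2[of t] unfolding \<open>min 1 (u\<^sup>2) = 1\<close> mult_1_right by linarith
qed

text \<open>With \<open>mbm_im\<close>, the real and imaginary parts of the kernel (exp(itu) - 1) /
  |u|^(H_t + 1/2). Splitting turns covariances into inner products of real functions.\<close>

definition mbm_re :: "(real \<Rightarrow> real) \<Rightarrow> real \<Rightarrow> real \<Rightarrow> real" where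
  "mbm_re H t u = (cos (t * u) - 1) * \<bar>u\<bar> powr (- (H t + 1/2))"

definition mbm_im :: "(real \<Rightarrow> real) \<Rightarrow> real \<Rightarrow> real \<Rightarrow> real" where
  "mbm_im H t u = sin (t * u) * \<bar>u\<bar> powr (- (H t + 1/2))"

lemma measurable_mbm_re_im [measurable]:
  "mbm_re H t \<in> borel_measurable borel" "mbm_im H t \<in> borel_measurable borel"
  unfolding mbm_re_def[abs_def] mbm_im_def[abs_def] by measurable

lemma powr_half_square: "(\<bar>u\<bar> powr (- (h + 1/2)))\<^sup>2 = \<bar>u\<bar> powr (- 2 * h - 1)" for u h :: real
proof -
  have "(\<bar>u\<bar> powr (- (h + 1/2)))\<^sup>2 = \<bar>u\<bar> powr (- (h + 1/2) + - (h + 1/2))"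
    unfolding power2_eq_square powr_add ..
  also have "- (h + 1/2) + - (h + 1/2) = - 2 * h - 1" by simp
  finally show ?thesis .
qed

lemma cos_sin_square_dist:
  "(cos x - cos y)\<^sup>2 + (sin x - sin y)\<^sup>2 = 2 - 2 * cos (x - y)" for x y :: real
proof -
  have "(cos x - cos y)\<^sup>2 + (sin x - sin y)\<^sup>2
      = ((cos x)\<^sup>2 + (sin x)\<^sup>2) + ((cos y)\<^sup>2 + (sin y)\<^sup>2) - 2 * (cos x * cos y + sin x * sin y)"
    by (simp add: power2_eq_square algebra_simps)
  then show ?thesis by (simp add: cos_diff)
qed

lemma mbm_re_im_square_le:
  "(mbm_re H t u)\<^sup>2 + (mbm_im H t u)\<^sup>2 \<le> (4 + t\<^sup>2) * spectral_majorant (H t) u"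
proof -
  have "(mbm_re H t u)\<^sup>2 + (mbm_im H t u)\<^sup>2 = (2 - 2 * cos (t * u)) * \<bar>u\<bar> powr (- 2 * H t - 1)"
    using cos_sin_square_dist[of "t * u" 0]
    unfolding mbm_re_def mbm_im_def power_mult_distrib powr_half_square distrib_right[symmetric] by simp
  also have "\<dots> \<le> ((4 + t\<^sup>2) * min 1 (u\<^sup>2)) * \<bar>u\<bar> powr (- 2 * H t - 1)"
    by (intro mult_right_mono two_minus_two_cos_le_scaled) simp
  finally show ?thesis by (simp add: spectral_majorant_def mult.assoc)
qed

section \<open>Covariances as L2 inner products of spectral kernels\<close>

lemma integrable_mult_of_square_integrable:
  fixes f g :: "'a \<Rightarrow> real"
  assumes [measurable]: "f \<in> borel_measurable M" "g \<in> borel_measurable M"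
    and "integrable M (\<lambda>x. (f x)\<^sup>2)" "integrable M (\<lambda>x. (g x)\<^sup>2)"
  shows "integrable M (\<lambda>x. f x * g x)"
proof (rule Bochner_Integration.integrable_bound)
  show "integrable M (\<lambda>x. (f x)\<^sup>2 + (g x)\<^sup>2)" using assms by simp
  have "\<bar>a * b\<bar> \<le> a\<^sup>2 + b\<^sup>2" for a b :: real
    using sum_squares_bound[of "\<bar>a\<bar>" "\<bar>b\<bar>"] 
      mult_nonneg_nonneg[of "\<bar>a\<bar>" "\<bar>b\<bar>"] unfolding abs_mult power2_abs by linarith
  then show "AE x in M. norm (f x * g x) \<le> norm ((f x)\<^sup>2 + (g x)\<^sup>2)" by simp
qed simp

lemma integral_double_sum:
  fixes A :: "nat \<Rightarrow> nat \<Rightarrow> 'a \<Rightarrow> real"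
  assumes int: "\<And>i j. i < n \<Longrightarrow> j < n \<Longrightarrow> integrable M (A i j)"
  shows "(\<integral>u. (\<Sum>i<n. \<Sum>j<n. c i * c j * A i j u) \<partial>M) = (\<Sum>i<n. \<Sum>j<n. c i * c j * (\<integral>u. A i j u \<partial>M))"
proof -
  have "integrable M (\<lambda>u. c i * c j * A i j u)" if "i < n" "j < n" for i j
    using int[OF that] by (rule integrable_mult_right)
  note * = this
  have 1: "(\<integral>u. (\<Sum>i<n. \<Sum>j<n. c i * c j * A i j u) \<partial>M) = (\<Sum>i<n. (\<integral>u. (\<Sum>j<n. c i * c j * A i j u) \<partial>M))"
    by (rule Bochner_Integration.integral_sum) (rule Bochner_Integration.integrable_sum, rule *, simp_all)
  have 2: "(\<integral>u. (\<Sum>j<n. c i * c j * A i j u) \<partial>M) = (\<Sum>j<n. c i * c j * (\<integral>u. A i j u \<partial>M))" if "i < n" for i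
  proof -
    have "(\<integral>u. (\<Sum>j<n. c i * c j * A i j u) \<partial>M) = (\<Sum>j<n. (\<integral>u. c i * c j * A i j u \<partial>M))"
      by (rule Bochner_Integration.integral_sum) (rule *[OF that], simp)
    then show ?thesis by simp
  qed
  show ?thesis unfolding 1 by (rule sum.cong) (simp_all add: 2)
qed

context
  fixes H :: "real \<Rightarrow> real" and h1 h2 :: real
  assumes h: "0 < h1" "h1 \<le> h2" "h2 < 1" and H: "\<And>t. 0 \<le> t \<Longrightarrow> h1 \<le> H t \<and> H t \<le> h2"
begin

lemma integrable_mbm_re_im_square:
  assumes "0 \<le> t"
  shows "integrable lborel (\<lambda>u. (mbm_re H t u)\<^sup>2)" "integrable lborel (\<lambda>u. (mbm_im H t u)\<^sup>2)"
proof -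
  have int: "integrable lborel (\<lambda>u. (4 + t\<^sup>2) * spectral_majorant (H t) u)"
    using H[OF assms] h by (intro integrable_mult_right integrable_spectral_majorant) auto
  have "(mbm_re H t u)\<^sup>2 \<le> (4 + t\<^sup>2) * spectral_majorant (H t) u"
    "(mbm_im H t u)\<^sup>2 \<le> (4 + t\<^sup>2) * spectral_majorant (H t) u" for u
    using mbm_re_im_square_le[of H t u] zero_le_power2[of "mbm_re H t u"] zero_le_power2[of "mbm_im H t u"]
    by linarith+
  then show "integrable lborel (\<lambda>u. (mbm_re H t u)\<^sup>2)" "integrable lborel (\<lambda>u. (mbm_im H t u)\<^sup>2)"
    by (auto intro!: Bochner_Integration.integrable_bound[OF int] simp: spectral_majorant_nonneg)
qed

lemma integrable_mbm_re_im_mult: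
  assumes "0 \<le> t" "0 \<le> s"
  shows "integrable lborel (\<lambda>u. mbm_re H t u * mbm_re H s u)"
    "integrable lborel (\<lambda>u. mbm_im H t u * mbm_im H s u)"
    "integrable lborel (\<lambda>u. mbm_im H t u * mbm_re H s u)"
    "integrable lborel (\<lambda>u. mbm_re H t u * mbm_im H s u)"
  by (intro integrable_mult_of_square_integrable integrable_mbm_re_im_square assms; simp)+

text \<open>The integrand of \<open>mbm_cov\<close> is the kernel at t times the conjugate kernel at
  s. Taking \<open>Re\<close> under the integral requires the complex integrand to be integrable,
  hence also its imaginary part \<open>?B\<close>; the mixed products of \<open>mbm_re\<close> and
  \<open>mbm_im\<close> serve that purpose.\<close>

lemma mbm_cov_eq:
  assumes "0 \<le> t" "0 \<le> s"
  shows "mbm_cov H t s = (1 / (2 * pi)) * (LINT u|lborel. mbm_re H t u * mbm_re H s u + mbm_im H t u * mbm_im H s u)"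
proof -
  let ?F = "\<lambda>u. (exp (\<i> * complex_of_real (t * u)) - 1) * (exp (- \<i> * complex_of_real (s * u)) - 1)
      / complex_of_real (\<bar>u\<bar> powr (H t + H s + 1))"
  let ?A = "\<lambda>u. mbm_re H t u * mbm_re H s u + mbm_im H t u * mbm_im H s u"
  let ?B = "\<lambda>u. mbm_im H t u * mbm_re H s u - mbm_re H t u * mbm_im H s u"
  have F: "?F u = complex_of_real (?A u) + \<i> * complex_of_real (?B u)" for u
  proof -
    have e1: "exp (\<i> * complex_of_real (t * u)) - 1 = Complex (cos (t * u) - 1) (sin (t * u))"
      unfolding cis_conv_exp[symmetric] by (simp add: complex_eq_iff)
    have "exp (- \<i> * complex_of_real (s * u)) = cis (- (s * u))"
      unfolding cis_conv_exp by simp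
    then have e2: "exp (- \<i> * complex_of_real (s * u)) - 1 = Complex (cos (s * u) - 1) (- sin (s * u))"
      by (simp add: complex_eq_iff)
    define a where "a = \<bar>u\<bar> powr (- (H t + 1/2))"
    define b where "b = \<bar>u\<bar> powr (- (H s + 1/2))"
    define c where "c = \<bar>u\<bar> powr (H t + H s + 1)"
    \<comment> \<open>True at u = 0 as well, where \<open>0 powr a = 0\<close> and
      \<open>inverse 0 = 0\<close>.\<close>
    have "inverse c = \<bar>u\<bar> powr (- (H t + 1/2) + - (H s + 1/2))"
      unfolding c_def powr_minus[symmetric] by (rule arg_cong2[where f = "(powr)"]) simp_all
    then have c: "z / c = z * (a * b)" for z
      unfolding a_def b_def powr_add by (simp only: divide_inverse)
    show ?thesis
      unfolding e1 e2 mbm_re_def mbm_im_def a_def[symmetric] b_def[symmetric] c_def[symmetric]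
      by (simp add: complex_eq_iff Re_divide_of_real Im_divide_of_real c algebra_simps)
  qed
  have intA: "integrable lborel ?A" and intB: "integrable lborel ?B"
    using integrable_mbm_re_im_mult[OF assms] by auto
  have "integrable lborel ?F"
    unfolding F
    by (rule Bochner_Integration.integrable_add[OF integrable_of_real[OF intA]
          integrable_mult_right[OF integrable_of_real[OF intB]]])
  then have "Re (integral\<^sup>L lborel ?F) = (LINT u|lborel. Re (?F u))"
    by (rule integral_Re[symmetric])
  also have "\<dots> = (LINT u|lborel. ?A u)" unfolding F by simp
  finally show ?thesis unfolding mbm_cov_def by simp
qed

text \<open>The variance of a linear combination is the squared L2 norm of the combined kernel. With
  two points and weights 1, -1 it yields the increment bound; with nonnegative weights it yields
  nondegeneracy.\<close>

lemma mbm_cov_quadratic_form: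
  fixes n :: nat and ts cs :: "nat \<Rightarrow> real"
  assumes "\<And>i. i < n \<Longrightarrow> 0 \<le> ts i"
  shows "(\<Sum>i<n. \<Sum>j<n. cs i * cs j * mbm_cov H (ts i) (ts j))
      = (1 / (2 * pi)) * (LINT u|lborel. (\<Sum>i<n. cs i * mbm_re H (ts i) u)\<^sup>2 + (\<Sum>i<n. cs i * mbm_im H (ts i) u)\<^sup>2)"
    and "integrable lborel (\<lambda>u. (\<Sum>i<n. cs i * mbm_re H (ts i) u)\<^sup>2 + (\<Sum>i<n. cs i * mbm_im H (ts i) u)\<^sup>2)"
proof -
  let ?A = "\<lambda>i j u. mbm_re H (ts i) u * mbm_re H (ts j) u + mbm_im H (ts i) u * mbm_im H (ts j) u"
  have int: "integrable lborel (?A i j)" if "i < n" "j < n" for i j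
    using integrable_mbm_re_im_mult[of "ts i" "ts j"] assms that by auto
  have eq: "(\<Sum>i<n. cs i * mbm_re H (ts i) u)\<^sup>2 + (\<Sum>i<n. cs i * mbm_im H (ts i) u)\<^sup>2
      = (\<Sum>i<n. \<Sum>j<n. cs i * cs j * ?A i j u)" for u
    unfolding power2_eq_square sum_product sum.distrib[symmetric] distrib_left
    by (intro sum.cong refl arg_cong2[where f = "(+)"]) (simp_all only: mult_ac)
  show "integrable lborel (\<lambda>u. (\<Sum>i<n. cs i * mbm_re H (ts i) u)\<^sup>2 + (\<Sum>i<n. cs i * mbm_im H (ts i) u)\<^sup>2)"
    unfolding eq by (intro Bochner_Integration.integrable_sum integrable_mult_right int) auto
  have swap: "(LINT u|lborel. (\<Sum>i<n. \<Sum>j<n. cs i * cs j * ?A i j u))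
      = (\<Sum>i<n. \<Sum>j<n. cs i * cs j * (LINT u|lborel. ?A i j u))"
    by (rule integral_double_sum) (rule int)
  have cov: "cs i * cs j * mbm_cov H (ts i) (ts j) = 1 / (2 * pi) * (cs i * cs j * (LINT u|lborel. ?A i j u))"
    if "i < n" "j < n" for i j
  proof -
    have cov: "mbm_cov H (ts i) (ts j) = 1 / (2 * pi) * (LINT u|lborel. ?A i j u)"
      using assms that by (intro mbm_cov_eq) auto
    show ?thesis unfolding cov by (rule mult.left_commute)
  qed
  show "(\<Sum>i<n. \<Sum>j<n. cs i * cs j * mbm_cov H (ts i) (ts j))
      = (1 / (2 * pi)) * (LINT u|lborel. (\<Sum>i<n. cs i * mbm_re H (ts i) u)\<^sup>2 + (\<Sum>i<n. cs i * mbm_im H (ts i) u)\<^sup>2)"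
    unfolding eq swap sum_distrib_left by (intro sum.cong refl) (simp only: cov lessThan_iff)
qed

text \<open>Nondegeneracy: for nonnegative weights the real parts \<open>cos (t u) - 1\<close> all have the same
sign, so nothing cancels; times in \<open>[1, 2]\<close> and frequencies in \<open>[1/2, 1]\<close> already suffice.\<close>
lemma mbm_cov_quadratic_form_ge:
  fixes n :: nat and ts cs :: "nat \<Rightarrow> real"
  assumes "\<And>i. i < n \<Longrightarrow> 0 \<le> ts i" "\<And>i. i < n \<Longrightarrow> 0 \<le> cs i"
  shows "((1 - cos (1/2)) * (\<Sum>i | i < n \<and> ts i \<in> {1..2}. cs i))\<^sup>2 / (4 * pi)
    \<le> (\<Sum>i<n. \<Sum>j<n. cs i * cs j * mbm_cov H (ts i) (ts j))"
proof -
  define S where "S = (1 - cos (1/2)) * (\<Sum>i | i < n \<and> ts i \<in> {1..2}. cs i)"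
  let ?P = "\<lambda>u. \<Sum>i<n. cs i * mbm_re H (ts i) u"
  let ?Q = "\<lambda>u. \<Sum>i<n. cs i * mbm_im H (ts i) u"
  have S0: "0 \<le> S" unfolding S_def by (intro mult_nonneg_nonneg sum_nonneg) (auto simp: assms)
  have P: "S \<le> - ?P u" if u: "u \<in> {1/2..1}" for u
  proof -
    have nonneg: "0 \<le> cs i * (- mbm_re H (ts i) u)" if "i < n" for i
      using assms(2)[OF that] by (intro mult_nonneg_nonneg) (auto simp: mbm_re_def mult_nonpos_nonneg)
    have "S \<le> (\<Sum>i | i < n \<and> ts i \<in> {1..2}. cs i * (- mbm_re H (ts i) u))"
      unfolding S_def sum_distrib_left
    proof (rule sum_mono)
      fix i assume i: "i \<in> {i. i < n \<and> ts i \<in> {1..2}}"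
      \<comment> \<open>The phase t u stays in [1/2, 2], inside [0, pi] where cos decreases, so 1 -
        cos(tu) is at least 1 - cos(1/2). The power of u is at least 1 because u <= 1.\<close>
      have "1 / 2 \<le> ts i * u" using mult_mono[of 1 "ts i" "1/2" u] i u by auto
      moreover have "ts i * u \<le> 2" using mult_mono[of "ts i" 2 u 1] i u by auto
      ultimately have c: "cos (ts i * u) \<le> cos (1/2)"
        using pi_gt3 by (intro cos_monotone_0_pi_le) auto
      have "1 \<le> u powr (- (H (ts i) + 1/2))"
      proof -
        have "1 powr (H (ts i) + 1/2) \<ge> u powr (H (ts i) + 1/2)"
          using H[of "ts i"] i u h by (intro powr_mono2) auto
        then show ?thesis using u unfolding powr_minus_divide by simp
      qed
      then have "(1 - cos (1/2)) * 1 \<le> (1 - cos (ts i * u)) * u powr (- (H (ts i) + 1/2))"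
        using c by (intro mult_mono) auto
      also have "\<dots> = - mbm_re H (ts i) u" using u by (simp add: mbm_re_def algebra_simps)
      finally show "(1 - cos (1/2)) * cs i \<le> cs i * (- mbm_re H (ts i) u)"
        using mult_left_mono[of "1 - cos (1/2)" "- mbm_re H (ts i) u" "cs i"] assms(2)[of i] i
        by (simp add: mult.commute)
    qed
    also have "\<dots> \<le> (\<Sum>i<n. cs i * (- mbm_re H (ts i) u))"
      by (rule sum_mono2) (use nonneg in auto)
    finally show ?thesis by (simp add: sum_negf)
  qed
  \<comment> \<open>The frequency band [1/2, 1] has length 1/2; with the prefactor 1 / (2 pi) this
    gives the 4 pi of the claim.\<close>
  have "S\<^sup>2 / 2 = (LINT u|lborel. indicator {1/2..1::real} u * S\<^sup>2)"
    by simp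
  also have "\<dots> \<le> (LINT u|lborel. (?P u)\<^sup>2 + (?Q u)\<^sup>2)"
  proof (rule integral_mono)
    show "integrable lborel (\<lambda>u. (?P u)\<^sup>2 + (?Q u)\<^sup>2)"
      using assms by (intro mbm_cov_quadratic_form(2))
    fix u :: real
    show "indicator {1/2..1} u * S\<^sup>2 \<le> (?P u)\<^sup>2 + (?Q u)\<^sup>2"
    proof (cases "u \<in> {1/2..1}")
      case True
      have "S\<^sup>2 \<le> (- ?P u)\<^sup>2" using P[OF True] S0 by (intro power_mono)
      then have "S\<^sup>2 \<le> (?P u)\<^sup>2" by simp
      then show ?thesis using True by (simp add: add_increasing2)
    qed simp
  qed (intro integrable_mult_left integrable_real_indicator emeasure_bounded_finite bounded_closed_interval; simp)
  finally have "S\<^sup>2 / 2 \<le> (LINT u|lborel. (?P u)\<^sup>2 + (?Q u)\<^sup>2)" .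
  then have "(1 / (2 * pi)) * (S\<^sup>2 / 2) \<le> (1 / (2 * pi)) * (LINT u|lborel. (?P u)\<^sup>2 + (?Q u)\<^sup>2)"
    by (intro mult_left_mono) auto
  moreover have "(1 / (2 * pi)) * (S\<^sup>2 / 2) = S\<^sup>2 / (4 * pi)" by simp
  ultimately show ?thesis using mbm_cov_quadratic_form(1)[of n ts cs] assms(1) unfolding S_def by simp
qed

end

section \<open>Variance of increments\<close>

lemma abs_exp_diff_le: "\<bar>exp a - exp b\<bar> \<le> \<bar>a - b\<bar> * exp (max a b)" for a b :: real
proof -
  have *: "exp y - exp x \<le> (y - x) * exp y" if "x \<le> y" for x y :: real
  proof -
    have "1 - exp (x - y) \<le> y - x" using exp_ge_add_one_self[of "x - y"] by linarith
    then have "(1 - exp (x - y)) * exp y \<le> (y - x) * exp y" by (intro mult_right_mono) auto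
    then show ?thesis by (simp add: algebra_simps exp_diff)
  qed
  show ?thesis
  proof (cases "a \<le> b")
    case True
    then show ?thesis using *[OF True] by (simp add: max_def abs_if)
  next
    case False
    then show ?thesis using *[of b a] by (simp add: max_def abs_if)
  qed
qed

text \<open>The factor \<open>ln x\<close> coming from the change of exponent is absorbed at the cost of a slightly
larger (near 0) or smaller (near infinity) exponent.\<close>
lemma abs_powr_diff_le:
  fixes x p q a b \<eta> :: real
  assumes "0 < x" "0 < \<eta>" "a \<le> p" "p \<le> b" "a \<le> q" "q \<le> b"
  shows "\<bar>x powr (- p) - x powr (- q)\<bar> \<le> \<bar>p - q\<bar> / \<eta> * x powr (if 1 \<le> x then \<eta> - a else - \<eta> - b)"
proof -
  have "\<bar>x powr (- p) - x powr (- q)\<bar> = \<bar>exp (- p * ln x) - exp (- q * ln x)\<bar>"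
    using assms by (simp add: powr_def)
  also have "\<dots> \<le> \<bar>- p * ln x - - q * ln x\<bar> * exp (max (- p * ln x) (- q * ln x))"
    by (rule abs_exp_diff_le)
  also have "\<bar>- p * ln x - - q * ln x\<bar> = \<bar>p - q\<bar> * \<bar>ln x\<bar>"
    by (simp add: abs_mult[symmetric] algebra_simps abs_minus_commute)
  also have "\<bar>p - q\<bar> * \<bar>ln x\<bar> * exp (max (- p * ln x) (- q * ln x))
     = \<bar>p - q\<bar> * (\<bar>ln x\<bar> * exp (max (- p * ln x) (- q * ln x)))" by simp
  also have "\<bar>ln x\<bar> * exp (max (- p * ln x) (- q * ln x)) \<le> x powr (if 1 \<le> x then \<eta> - a else - \<eta> - b) / \<eta>"
  proof (cases "1 \<le> x")
    case True
    have "\<bar>ln x\<bar> \<le> x powr \<eta> / \<eta>" using ln_powr_bound[OF True \<open>0 < \<eta>\<close>] True by simp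
    moreover have "exp (max (- p * ln x) (- q * ln x)) \<le> x powr (- a)"
      using True assms by (auto simp: powr_def mult_right_mono)
    ultimately have "\<bar>ln x\<bar> * exp (max (- p * ln x) (- q * ln x)) \<le> (x powr \<eta> / \<eta>) * x powr (- a)"
      using \<open>0 < \<eta>\<close> by (intro mult_mono) auto
    also have "\<dots> = x powr (\<eta> - a) / \<eta>" by (simp add: powr_diff powr_minus_divide)
    finally show ?thesis using True by simp
  next
    case False
    have "\<bar>ln x\<bar> = ln (1 / x)" using False assms by (simp add: ln_div)
    also have "\<dots> \<le> (1 / x) powr \<eta> / \<eta>"
      using False assms by (intro ln_powr_bound) auto
    also have "\<dots> = x powr (- \<eta>) / \<eta>" using assms by (simp add: powr_divide powr_minus_divide)
    finally have "\<bar>ln x\<bar> \<le> x powr (- \<eta>) / \<eta>" .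
    moreover have "exp (max (- p * ln x) (- q * ln x)) \<le> x powr (- b)"
      using False assms by (auto simp: powr_def intro!: mult_right_mono_neg)
    ultimately have "\<bar>ln x\<bar> * exp (max (- p * ln x) (- q * ln x)) \<le> (x powr (- \<eta>) / \<eta>) * x powr (- b)"
      using \<open>0 < \<eta>\<close> by (intro mult_mono) auto
    also have "\<dots> = x powr (- \<eta> - b) / \<eta>" by (simp add: powr_diff powr_minus_divide)
    finally show ?thesis using False by simp
  qed
  finally show ?thesis by (simp add: mult_left_mono)
qed

text \<open>Interpolation between the bounds 1 and x^2. It extracts exactly the power 2 gamma of a
  time increment at high frequencies.\<close>

lemma min_square_le_powr: "min 1 (x\<^sup>2) \<le> \<bar>x\<bar> powr (2 * \<gamma>)" if "0 < \<gamma>" "\<gamma> \<le> 1" for x \<gamma> :: real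
proof (cases "\<bar>x\<bar> \<le> 1")
  case True
  show ?thesis
  proof (cases "x = 0")
    case False
    have "x\<^sup>2 = \<bar>x\<bar> powr 2" using False by (simp add: powr_numeral)
    also have "\<dots> \<le> \<bar>x\<bar> powr (2 * \<gamma>)" using True that by (intro powr_mono') auto
    finally show ?thesis by simp
  qed simp
next
  case False
  then have "1 \<le> \<bar>x\<bar> powr (2 * \<gamma>)" using that by (intro ge_one_powr_ge_zero) auto
  then show ?thesis by simp
qed

text \<open>Estimates that use different exponents on the two sides of |u| = 1 are absorbed by a sum
  of two majorants, so no piecewise function has to be integrated.\<close>

lemma spectral_majorant_add_ge:
  assumes "0 < \<bar>u\<bar>" "\<bar>u\<bar> < 1 \<Longrightarrow> z \<le> u\<^sup>2 * \<bar>u\<bar> powr (- 2 * h' - 1)"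
    and "1 \<le> \<bar>u\<bar> \<Longrightarrow> z \<le> \<bar>u\<bar> powr (- 2 * h - 1)"
  shows "z \<le> spectral_majorant h' u + spectral_majorant h u"
proof (cases "\<bar>u\<bar> < 1")
  case True
  then have "u\<^sup>2 \<le> 1" by (simp add: abs_square_le_1)
  then have "spectral_majorant h' u = u\<^sup>2 * \<bar>u\<bar> powr (- 2 * h' - 1)"
    by (simp add: spectral_majorant_def)
  then show ?thesis using assms(2)[OF True] spectral_majorant_nonneg[of h u] by linarith
next
  case False
  then have "1 \<le> u\<^sup>2" using abs_square_less_1[of u] by linarith
  then have "spectral_majorant h u = \<bar>u\<bar> powr (- 2 * h - 1)"
    by (simp add: spectral_majorant_def)
  then show ?thesis using assms(3) False spectral_majorant_nonneg[of h' u] by linarith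
qed

text \<open>The bound is uniform over the exponents h allowed. At low frequencies h2 is the worst
  exponent and delta^2 <= delta^(2 gamma); at high frequencies interpolation costs |u|^(2 gamma),
  and gamma + eta <= h still leaves the decay |u|^(-2 eta - 1).\<close>

lemma time_increment_le:
  fixes \<delta> u \<gamma> \<eta> h :: real
  assumes "0 \<le> \<delta>" "\<delta> \<le> 1" "0 < \<gamma>" "\<gamma> \<le> 1" "\<gamma> + \<eta> \<le> h" "h \<le> h2"
  shows "(2 - 2 * cos (\<delta> * u)) * \<bar>u\<bar> powr (- 2 * h - 1)
    \<le> 4 * \<delta> powr (2 * \<gamma>) * (spectral_majorant h2 u + spectral_majorant \<eta> u)"
proof (cases "u = 0")
  case True
  then show ?thesis by (simp add: spectral_majorant_def)
next
  case False
  have four: "2 - 2 * cos (\<delta> * u) \<le> 4 * min 1 ((\<delta> * u)\<^sup>2)"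
  proof -
    have "min 4 ((\<delta> * u)\<^sup>2) \<le> 4 * min 1 ((\<delta> * u)\<^sup>2)" by (auto simp: min_def)
    then show ?thesis using two_minus_two_cos_le[of "\<delta> * u"] by linarith
  qed
  have "min 1 ((\<delta> * u)\<^sup>2) * \<bar>u\<bar> powr (- 2 * h - 1)
      \<le> \<delta> powr (2 * \<gamma>) * (spectral_majorant h2 u + spectral_majorant \<eta> u)"
  proof (cases "\<delta> = 0")
    case False
    with assms have "\<delta> > 0" by simp
    define w where "w = min 1 ((\<delta> * u)\<^sup>2) * \<bar>u\<bar> powr (- 2 * h - 1) / \<delta> powr (2 * \<gamma>)"
    have "w \<le> spectral_majorant h2 u + spectral_majorant \<eta> u"
    proof (rule spectral_majorant_add_ge)
      assume u: "\<bar>u\<bar> < 1"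
      have "min 1 ((\<delta> * u)\<^sup>2) \<le> \<delta>\<^sup>2 * u\<^sup>2" by (simp add: power_mult_distrib)
      also have "\<delta>\<^sup>2 \<le> \<delta> powr (2 * \<gamma>)"
        using powr_mono'[of "2 * \<gamma>" 2 \<delta>] assms \<open>\<delta> > 0\<close> by (simp add: powr_numeral)
      finally have "min 1 ((\<delta> * u)\<^sup>2) \<le> \<delta> powr (2 * \<gamma>) * u\<^sup>2" by (simp add: mult_right_mono)
      moreover have "\<bar>u\<bar> powr (- 2 * h - 1) \<le> \<bar>u\<bar> powr (- 2 * h2 - 1)"
        using u assms by (intro powr_mono') auto
      ultimately have "min 1 ((\<delta> * u)\<^sup>2) * \<bar>u\<bar> powr (- 2 * h - 1) \<le> (\<delta> powr (2 * \<gamma>) * u\<^sup>2) * \<bar>u\<bar> powr (- 2 * h2 - 1)"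
        by (intro mult_mono) auto
      then show "w \<le> u\<^sup>2 * \<bar>u\<bar> powr (- 2 * h2 - 1)"
        using \<open>\<delta> > 0\<close> by (simp add: w_def divide_le_eq mult_ac)
    next
      assume u: "1 \<le> \<bar>u\<bar>"
      have "min 1 ((\<delta> * u)\<^sup>2) * \<bar>u\<bar> powr (- 2 * h - 1) \<le> \<bar>\<delta> * u\<bar> powr (2 * \<gamma>) * \<bar>u\<bar> powr (- 2 * h - 1)"
        using assms by (intro mult_right_mono min_square_le_powr) auto
      also have "\<dots> = \<delta> powr (2 * \<gamma>) * \<bar>u\<bar> powr (2 * \<gamma> + (- 2 * h - 1))"
        using \<open>\<delta> > 0\<close> by (simp only: abs_mult powr_add powr_mult abs_of_pos abs_ge_zero less_imp_le mult.assoc)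
      also have "\<dots> \<le> \<delta> powr (2 * \<gamma>) * \<bar>u\<bar> powr (- 2 * \<eta> - 1)"
        using u assms by (intro mult_left_mono powr_mono) auto
      finally show "w \<le> \<bar>u\<bar> powr (- 2 * \<eta> - 1)"
        using \<open>\<delta> > 0\<close> by (simp add: w_def divide_le_eq mult_ac)
    qed (use \<open>u \<noteq> 0\<close> in simp)
    then show ?thesis using \<open>\<delta> > 0\<close> by (simp add: w_def divide_le_eq mult_ac)
  qed simp
  moreover have "(2 - 2 * cos (\<delta> * u)) * \<bar>u\<bar> powr (- 2 * h - 1) \<le> 4 * min 1 ((\<delta> * u)\<^sup>2) * \<bar>u\<bar> powr (- 2 * h - 1)"
    using four by (intro mult_right_mono) auto
  ultimately show ?thesis by simp
qed

text \<open>Changing the exponent creates a logarithm, paid for by a shift of eta: h2 + eta governs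
  the low and h1 - eta the high frequencies. The factor min 1 u^2 comes from the time factor
  exp(isu) - 1 and restores integrability at 0 when h2 + eta < 1.\<close>

lemma exponent_increment_le:
  fixes u p q h1 h2 \<eta> :: real
  assumes "0 < \<eta>" "h1 \<le> p" "p \<le> h2" "h1 \<le> q" "q \<le> h2"
  shows "min 1 (u\<^sup>2) * (\<bar>u\<bar> powr (- (p + 1/2)) - \<bar>u\<bar> powr (- (q + 1/2)))\<^sup>2
    \<le> ((p - q) / \<eta>)\<^sup>2 * (spectral_majorant (h2 + \<eta>) u + spectral_majorant (h1 - \<eta>) u)"
proof (cases "u = 0 \<or> p = q")
  case True
  then show ?thesis by (auto simp: spectral_majorant_def)
next
  case False
  define e where "e = (if 1 \<le> \<bar>u\<bar> then \<eta> - (h1 + 1/2) else - \<eta> - (h2 + 1/2))"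
  have "\<bar>\<bar>u\<bar> powr (- (p + 1/2)) - \<bar>u\<bar> powr (- (q + 1/2))\<bar> \<le> \<bar>(p + 1/2) - (q + 1/2)\<bar> / \<eta> * \<bar>u\<bar> powr e"
    unfolding e_def using False assms by (intro abs_powr_diff_le) auto
  then have "(\<bar>\<bar>u\<bar> powr (- (p + 1/2)) - \<bar>u\<bar> powr (- (q + 1/2))\<bar>)\<^sup>2 \<le> (\<bar>p - q\<bar> / \<eta> * \<bar>u\<bar> powr e)\<^sup>2"
    by (intro power_mono) auto
  then have sq: "(\<bar>u\<bar> powr (- (p + 1/2)) - \<bar>u\<bar> powr (- (q + 1/2)))\<^sup>2 \<le> ((p - q) / \<eta>)\<^sup>2 * (\<bar>u\<bar> powr e)\<^sup>2"
    by (simp add: power_mult_distrib power_divide)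
  have "min 1 (u\<^sup>2) * (\<bar>u\<bar> powr e)\<^sup>2 \<le> spectral_majorant (h2 + \<eta>) u + spectral_majorant (h1 - \<eta>) u"
  proof (rule spectral_majorant_add_ge)
    have pe: "(\<bar>u\<bar> powr e)\<^sup>2 = \<bar>u\<bar> powr (2 * e)"
      by (simp add: power2_eq_square powr_add[symmetric])
    show "min 1 (u\<^sup>2) * (\<bar>u\<bar> powr e)\<^sup>2 \<le> u\<^sup>2 * \<bar>u\<bar> powr (- 2 * (h2 + \<eta>) - 1)" if "\<bar>u\<bar> < 1"
    proof -
      have "2 * e = - 2 * (h2 + \<eta>) - 1" using that by (simp add: e_def algebra_simps)
      then show ?thesis unfolding pe by (intro mult_mono) auto
    qed
    show "min 1 (u\<^sup>2) * (\<bar>u\<bar> powr e)\<^sup>2 \<le> \<bar>u\<bar> powr (- 2 * (h1 - \<eta>) - 1)" if "1 \<le> \<bar>u\<bar>"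
    proof -
      have "2 * e = - 2 * (h1 - \<eta>) - 1" using that by (simp add: e_def algebra_simps)
      then have "min 1 (u\<^sup>2) * (\<bar>u\<bar> powr e)\<^sup>2 \<le> 1 * \<bar>u\<bar> powr (- 2 * (h1 - \<eta>) - 1)"
        unfolding pe by (intro mult_mono) auto
      then show ?thesis by simp
    qed
  qed (use False in simp)
  then have "((p - q) / \<eta>)\<^sup>2 * (min 1 (u\<^sup>2) * (\<bar>u\<bar> powr e)\<^sup>2)
      \<le> ((p - q) / \<eta>)\<^sup>2 * (spectral_majorant (h2 + \<eta>) u + spectral_majorant (h1 - \<eta>) u)"
    by (intro mult_left_mono) auto
  moreover have "min 1 (u\<^sup>2) * (\<bar>u\<bar> powr (- (p + 1/2)) - \<bar>u\<bar> powr (- (q + 1/2)))\<^sup>2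
      \<le> min 1 (u\<^sup>2) * (((p - q) / \<eta>)\<^sup>2 * (\<bar>u\<bar> powr e)\<^sup>2)"
    using sq by (intro mult_left_mono) auto
  ultimately show ?thesis by (simp add: mult_ac)
qed

text \<open>The kernel difference is split as (exp(itu) - exp(isu)) a + (exp(isu) - 1) (a - b),
  where a and b are the power weights at t and s: first the time moves with the exponent frozen,
  then the exponent moves with the time frozen.\<close>

lemma mbm_re_im_increment_square_le:
  "(mbm_re H t u - mbm_re H s u)\<^sup>2 + (mbm_im H t u - mbm_im H s u)\<^sup>2
    \<le> 2 * ((2 - 2 * cos ((t - s) * u)) * \<bar>u\<bar> powr (- 2 * H t - 1))
      + 2 * ((2 - 2 * cos (s * u)) * (\<bar>u\<bar> powr (- (H t + 1/2)) - \<bar>u\<bar> powr (- (H s + 1/2)))\<^sup>2)"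
proof -
  define a where "a = \<bar>u\<bar> powr (- (H t + 1/2))"
  define b where "b = \<bar>u\<bar> powr (- (H s + 1/2))"
  have re: "mbm_re H t u - mbm_re H s u = (cos (t * u) - cos (s * u)) * a + (cos (s * u) - 1) * (a - b)"
    by (simp add: mbm_re_def a_def b_def algebra_simps)
  have im: "mbm_im H t u - mbm_im H s u = (sin (t * u) - sin (s * u)) * a + sin (s * u) * (a - b)"
    by (simp add: mbm_im_def a_def b_def algebra_simps)
  have sq: "(x + y)\<^sup>2 \<le> 2 * x\<^sup>2 + 2 * y\<^sup>2" for x y :: real
    using sum_squares_bound[of x y] by (simp add: power2_sum)
  have "(mbm_re H t u - mbm_re H s u)\<^sup>2 + (mbm_im H t u - mbm_im H s u)\<^sup>2
    \<le> (2 * ((cos (t * u) - cos (s * u)) * a)\<^sup>2 + 2 * ((cos (s * u) - 1) * (a - b))\<^sup>2)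
      + (2 * ((sin (t * u) - sin (s * u)) * a)\<^sup>2 + 2 * (sin (s * u) * (a - b))\<^sup>2)"
    unfolding re im by (intro add_mono sq)
  also have "\<dots> = 2 * (((cos (t * u) - cos (s * u))\<^sup>2 + (sin (t * u) - sin (s * u))\<^sup>2) * a\<^sup>2)
      + 2 * (((cos (s * u) - 1)\<^sup>2 + (sin (s * u))\<^sup>2) * (a - b)\<^sup>2)"
    unfolding power_mult_distrib by (simp add: distrib_right)
  also have "(cos (t * u) - cos (s * u))\<^sup>2 + (sin (t * u) - sin (s * u))\<^sup>2 = 2 - 2 * cos ((t - s) * u)"
    by (simp only: cos_sin_square_dist left_diff_distrib)
  also have "(cos (s * u) - 1)\<^sup>2 + (sin (s * u))\<^sup>2 = 2 - 2 * cos (s * u)"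
    using cos_sin_square_dist[of "s * u" 0] by simp
  finally show ?thesis
    unfolding a_def b_def powr_half_square .
qed

text \<open>The order gamma is capped from two sides: by h1 through the motion of the time, and by
  kappa through the motion of the exponent. The growth in s comes from the second part, via 4 + s^2
  <= 4 (1 + s)^2.\<close>

lemma mbm_increment_variance_le:
  fixes H :: "real \<Rightarrow> real" and h1 h2 D \<kappa> \<gamma> \<eta> :: real
  assumes h: "0 < h1" "h1 \<le> h2" "h2 < 1" and H: "\<And>t. 0 \<le> t \<Longrightarrow> h1 \<le> H t \<and> H t \<le> h2"
    and Hol: "\<And>t s. 0 < s \<Longrightarrow> s \<le> t \<Longrightarrow> \<bar>H t - H s\<bar> \<le> D * (t - s) powr \<kappa>"
    and \<eta>: "0 < \<eta>" "\<gamma> + \<eta> \<le> h1" "h2 + \<eta> < 1" and \<gamma>: "0 < \<gamma>" "\<gamma> \<le> \<kappa>"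
  shows "\<exists>C\<ge>0. \<forall>s t. 0 \<le> s \<longrightarrow> s \<le> t \<longrightarrow> t - s \<le> 1 \<longrightarrow>
    mbm_cov H t t - mbm_cov H t s - mbm_cov H s t + mbm_cov H s s \<le> C * (1 + s)\<^sup>2 * (t - s) powr (2 * \<gamma>)"
proof -
  \<comment> \<open>Each 8 is the 2 from squaring a sum of two terms times a 4 from the respective
    estimate; what remains depends on neither s nor t.\<close>
  define G where "G u = 8 * (spectral_majorant h2 u + spectral_majorant \<eta> u)
    + 8 * (D / \<eta>)\<^sup>2 * (spectral_majorant (h2 + \<eta>) u + spectral_majorant (h1 - \<eta>) u)" for u
  have intG: "integrable lborel G"
    unfolding G_def using h \<eta> \<gamma>
    by (intro Bochner_Integration.integrable_add integrable_mult_right integrable_spectral_majorant) auto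
  have G0: "0 \<le> G u" for u by (simp add: G_def spectral_majorant_nonneg)
  define C where "C = (1 / (2 * pi)) * (LINT u|lborel. G u)"
  have "0 \<le> C" unfolding C_def by (simp add: G0)
  have "mbm_cov H t t - mbm_cov H t s - mbm_cov H s t + mbm_cov H s s \<le> C * (1 + s)\<^sup>2 * (t - s) powr (2 * \<gamma>)"
    if st: "0 \<le> s" "s \<le> t" "t - s \<le> 1" for s t
  proof -
    let ?\<delta> = "(t - s) powr (2 * \<gamma>)"
    let ?I = "\<lambda>u. (mbm_re H t u - mbm_re H s u)\<^sup>2 + (mbm_im H t u - mbm_im H s u)\<^sup>2"
    have pt: "?I u \<le> ((1 + s)\<^sup>2 * ?\<delta>) * G u" for u
    proof -
      have "(2 - 2 * cos ((t - s) * u)) * \<bar>u\<bar> powr (- 2 * H t - 1)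
          \<le> 4 * ?\<delta> * (spectral_majorant h2 u + spectral_majorant \<eta> u)"
        using st \<eta> \<gamma> h H[of t] by (intro time_increment_le) auto
      also have "\<dots> \<le> ((1 + s)\<^sup>2 * (4 * ?\<delta>)) * (spectral_majorant h2 u + spectral_majorant \<eta> u)"
      proof -
        have "1 \<le> (1 + s)\<^sup>2" using st by (simp add: power2_eq_square algebra_simps)
        from mult_right_mono[OF this, of "4 * ?\<delta>"] show ?thesis
          by (intro mult_right_mono) (auto simp: spectral_majorant_nonneg)
      qed
      finally have 1: "(2 - 2 * cos ((t - s) * u)) * \<bar>u\<bar> powr (- 2 * H t - 1)
          \<le> ((1 + s)\<^sup>2 * (4 * ?\<delta>)) * (spectral_majorant h2 u + spectral_majorant \<eta> u)" .
      let ?d = "(\<bar>u\<bar> powr (- (H t + 1/2)) - \<bar>u\<bar> powr (- (H s + 1/2)))\<^sup>2"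
      let ?S = "spectral_majorant (h2 + \<eta>) u + spectral_majorant (h1 - \<eta>) u"
      have S0: "0 \<le> ?S" by (simp add: spectral_majorant_nonneg)
      have 2: "(2 - 2 * cos (s * u)) * ?d \<le> ((1 + s)\<^sup>2 * (4 * ?\<delta>)) * ((D / \<eta>)\<^sup>2 * ?S)"
      \<comment> \<open>The Hoelder condition on \<open>H\<close> speaks only of s > 0; at s = 0 the
        factor 2 - 2 cos(su) vanishes.\<close>
      proof (cases "s = 0")
        case True
        then show ?thesis using S0 by simp
      next
        case False
        have "\<bar>H t - H s\<bar> \<le> D * (t - s) powr \<kappa>" using False st by (intro Hol) auto
        then have "\<bar>H t - H s\<bar>\<^sup>2 \<le> (D * (t - s) powr \<kappa>)\<^sup>2" by (intro power_mono) auto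
        also have "(D * (t - s) powr \<kappa>)\<^sup>2 = D\<^sup>2 * (t - s) powr (2 * \<kappa>)"
          by (simp add: power_mult_distrib power2_eq_square powr_add[symmetric])
        also have "\<dots> \<le> D\<^sup>2 * ?\<delta>"
          using st \<gamma> by (intro mult_left_mono powr_mono') auto
        finally have HH: "(H t - H s)\<^sup>2 \<le> D\<^sup>2 * ?\<delta>" by simp
        have "(2 - 2 * cos (s * u)) * ?d \<le> ((4 + s\<^sup>2) * min 1 (u\<^sup>2)) * ?d"
          by (intro mult_right_mono two_minus_two_cos_le_scaled) auto
        also have "\<dots> = (4 + s\<^sup>2) * (min 1 (u\<^sup>2) * ?d)" by simp
        also have "\<dots> \<le> (4 + s\<^sup>2) * (((H t - H s) / \<eta>)\<^sup>2 * ?S)"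
          using st \<eta> H[of t] H[of s] by (intro mult_left_mono exponent_increment_le) auto
        also have "\<dots> \<le> (4 * (1 + s)\<^sup>2) * (((D / \<eta>)\<^sup>2 * ?\<delta>) * ?S)"
        proof (intro mult_mono mult_right_mono)
          show "4 + s\<^sup>2 \<le> 4 * (1 + s)\<^sup>2" using st by (simp add: power2_eq_square algebra_simps)
          show "((H t - H s) / \<eta>)\<^sup>2 \<le> (D / \<eta>)\<^sup>2 * ?\<delta>"
            using HH by (simp add: power_divide divide_right_mono)
        qed (use S0 in auto)
        finally show ?thesis by (simp add: mult_ac)
      qed
      show ?thesis
        using mbm_re_im_increment_square_le[of H t u s] 1 2 unfolding G_def by (simp add: algebra_simps)
    qed
    let ?ts = "\<lambda>i::nat. if i = 0 then t else s" and ?cs = "\<lambda>i::nat. if i = 0 then 1 else -1::real"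
    have two: "{..<2::nat} = {0, 1}" by auto
    have "mbm_cov H t t - mbm_cov H t s - mbm_cov H s t + mbm_cov H s s
        = (\<Sum>i<2. \<Sum>j<2. ?cs i * ?cs j * mbm_cov H (?ts i) (?ts j))"
      unfolding two by simp
    also have "\<dots> = (1 / (2 * pi)) * (LINT u|lborel. (\<Sum>i<2. ?cs i * mbm_re H (?ts i) u)\<^sup>2 + (\<Sum>i<2. ?cs i * mbm_im H (?ts i) u)\<^sup>2)"
      using st by (intro mbm_cov_quadratic_form(1)[OF h H]) auto
    also have "\<dots> = (1 / (2 * pi)) * (LINT u|lborel. ?I u)" unfolding two by simp
    also have "\<dots> \<le> (1 / (2 * pi)) * (LINT u|lborel. ((1 + s)\<^sup>2 * ?\<delta>) * G u)"
    proof (intro mult_left_mono integral_mono)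
      have "integrable lborel (\<lambda>u. (\<Sum>i<2. ?cs i * mbm_re H (?ts i) u)\<^sup>2 + (\<Sum>i<2. ?cs i * mbm_im H (?ts i) u)\<^sup>2)"
        using st by (intro mbm_cov_quadratic_form(2)[OF h H]) auto
      then show "integrable lborel ?I" unfolding two by simp
    qed (use intG pt in auto)
    also have "\<dots> = C * (1 + s)\<^sup>2 * ?\<delta>" by (simp add: C_def)
    finally show ?thesis .
  qed
  then show ?thesis using \<open>0 \<le> C\<close> by blast
qed

section \<open>Moments and sample path regularity\<close>

lemma centered_gaussian_process_measurable:
  assumes "centered_gaussian_process M Y K" "0 \<le> t"
  shows "Y t \<in> borel_measurable M"
proof -
  have "centered_normal_rv M (\<lambda>\<omega>. \<Sum>i<1::nat. 1 * Y t \<omega>) (\<Sum>i<1::nat. \<Sum>j<1::nat. 1 * 1 * K t t)"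
    using assms(1)[unfolded centered_gaussian_process_def, rule_format, of 1 "\<lambda>_. t" "\<lambda>_. 1"] assms(2) by simp
  then show ?thesis by (simp add: centered_normal_rv_def)
qed

lemma centered_gaussian_process_increment:
  assumes "centered_gaussian_process M Y K" "0 \<le> t" "0 \<le> s"
  shows "centered_normal_rv M (\<lambda>\<omega>. Y t \<omega> - Y s \<omega>) (K t t - K t s - K s t + K s s)"
proof -
  let ?ts = "\<lambda>i::nat. if i = 0 then t else s" and ?cs = "\<lambda>i::nat. if i = 0 then 1 else -1::real"
  have "centered_normal_rv M (\<lambda>\<omega>. \<Sum>i<2. ?cs i * Y (?ts i) \<omega>) (\<Sum>i<2. \<Sum>j<2. ?cs i * ?cs j * K (?ts i) (?ts j))"
    using assms(1)[unfolded centered_gaussian_process_def, rule_format, of 2 ?ts ?cs] assms(2,3) by simp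
  moreover have "{..<2::nat} = {0, 1}" by auto
  ultimately show ?thesis by (simp add: algebra_simps)
qed

text \<open>The Gaussian moment (2q)! / (2^q q!) v^q, with v enlarged to w. A degenerate variable
  has no density and is treated apart; there q > 0 ensures that the moment is 0.\<close>

lemma centered_normal_rv_even_moment_le:
  assumes Z: "centered_normal_rv M Z v" and "v \<le> w" "0 < q"
  shows "(\<integral>\<^sup>+\<omega>. ennreal (Z \<omega> ^ (2 * q)) \<partial>M) \<le> ennreal (fact (2 * q) / (2 ^ q * fact q) * w ^ q)"
proof (cases "v = 0")
  case True
  then have "AE \<omega> in M. Z \<omega> = 0" using Z by (simp add: centered_normal_rv_def)
  then have "AE \<omega> in M. ennreal (Z \<omega> ^ (2 * q)) = 0" by eventually_elim (use \<open>0 < q\<close> in simp)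
  then have "(\<integral>\<^sup>+\<omega>. ennreal (Z \<omega> ^ (2 * q)) \<partial>M) = (\<integral>\<^sup>+\<omega>. 0 \<partial>M)" by (rule nn_integral_cong_AE)
  then show ?thesis by simp
next
  case False
  then have "v > 0" and dist: "distributed M lborel Z (normal_density 0 (sqrt v))"
    using Z by (auto simp: centered_normal_rv_def)
  have hbi: "has_bochner_integral lborel (\<lambda>x. normal_density 0 (sqrt v) x * x ^ (2 * q))
      (fact (2 * q) / ((2 / v) ^ q * fact q))"
    using normal_moment_even[of "sqrt v" 0 q] \<open>v > 0\<close> by simp
  have "(\<integral>\<^sup>+\<omega>. ennreal (Z \<omega> ^ (2 * q)) \<partial>M) = (\<integral>\<^sup>+x. ennreal (normal_density 0 (sqrt v) x) * ennreal (x ^ (2 * q)) \<partial>lborel)"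
    by (rule distributed_nn_integral[OF dist, symmetric]) simp
  also have "\<dots> = (\<integral>\<^sup>+x. ennreal (normal_density 0 (sqrt v) x * x ^ (2 * q)) \<partial>lborel)"
    by (simp add: ennreal_mult)
  also have "\<dots> = ennreal (\<integral>x. normal_density 0 (sqrt v) x * x ^ (2 * q) \<partial>lborel)"
    using hbi by (intro nn_integral_eq_integral) (auto simp: has_bochner_integral_iff)
  also have "\<dots> = ennreal (fact (2 * q) / (2 ^ q * fact q) * v ^ q)"
    using hbi by (simp add: has_bochner_integral_iff power_divide)
  also have "\<dots> \<le> ennreal (fact (2 * q) / (2 ^ q * fact q) * w ^ q)"
    using \<open>v > 0\<close> \<open>v \<le> w\<close> by (intro ennreal_leI mult_left_mono power_mono) auto
  finally show ?thesis .
qed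

lemma suminf_geometric_inverse_squares_finite:
  "(\<Sum>m. \<Sum>k. ennreal (A * (1 / 2) ^ m / (real k + 1)\<^sup>2)) < \<infinity>"
proof -
  define A' where "A' = \<bar>A\<bar>"
  have "summable (\<lambda>k. inverse ((real (Suc k))\<^sup>2))"
    using inverse_power_summable[of 2, where 'a = real] by (subst summable_Suc_iff) simp
  then have sk: "summable (\<lambda>k. 1 / (real k + 1)\<^sup>2)"
    by (simp add: inverse_eq_divide add.commute)
  define Q where "Q = (\<Sum>k. 1 / (real k + 1)\<^sup>2)"
  have inner: "(\<Sum>k. ennreal (A * (1 / 2) ^ m / (real k + 1)\<^sup>2)) \<le> ennreal (A' * (1 / 2) ^ m * Q)" for m
  proof -
    have "(\<Sum>k. ennreal (A * (1 / 2) ^ m / (real k + 1)\<^sup>2)) \<le> (\<Sum>k. ennreal (A' * (1 / 2) ^ m * (1 / (real k + 1)\<^sup>2)))"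
      by (intro suminf_le summableI ennreal_leI) (simp add: A'_def divide_right_mono mult_right_mono)
    also have "\<dots> = ennreal (\<Sum>k. A' * (1 / 2) ^ m * (1 / (real k + 1)\<^sup>2))"
      by (intro suminf_ennreal2 summable_mult sk) (simp add: A'_def)
    also have "\<dots> = ennreal (A' * (1 / 2) ^ m * Q)" unfolding Q_def by (subst suminf_mult[OF sk]) simp
    finally show ?thesis .
  qed
  have "0 \<le> Q" unfolding Q_def by (intro suminf_nonneg sk) simp
  have sm: "summable (\<lambda>m. A' * (1 / 2) ^ m * Q)"
    by (intro summable_mult summable_mult2 summable_geometric) simp
  have "(\<Sum>m. \<Sum>k. ennreal (A * (1 / 2) ^ m / (real k + 1)\<^sup>2)) \<le> (\<Sum>m. ennreal (A' * (1 / 2) ^ m * Q))"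
    by (intro suminf_le summableI inner)
  also have "\<dots> = ennreal (\<Sum>m. A' * (1 / 2) ^ m * Q)"
    using \<open>0 \<le> Q\<close> by (intro suminf_ennreal2 sm) (simp add: A'_def)
  also have "\<dots> < \<infinity>" by simp
  finally show ?thesis .
qed

text \<open>The weighted double series of the \<open>2 q\<close>-th powers of all dyadic increments has finite
expectation, hence is almost surely finite and bounds each of its terms.\<close>
lemma AE_dyadic_increments_bounded:
  fixes Y :: "real \<Rightarrow> 'a \<Rightarrow> real" and \<gamma> \<gamma>' C :: real
  assumes gp: "centered_gaussian_process M Y K"
    and "0 \<le> C" "\<gamma>' < \<gamma>"
    and var: "\<And>s t. 0 \<le> s \<Longrightarrow> s \<le> t \<Longrightarrow> t - s \<le> 1 \<Longrightarrow>
        K t t - K t s - K s t + K s s \<le> C * (1 + s)\<^sup>2 * (t - s) powr (2 * \<gamma>)"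
  shows "AE \<omega> in M. \<exists>B\<ge>0. \<forall>m k. \<bar>Y (real (Suc k) / 2 ^ m) \<omega> - Y (real k / 2 ^ m) \<omega>\<bar>
      \<le> B * (1 + real k / 2 ^ m)\<^sup>2 * (2 powr (- \<gamma>')) ^ m"
proof -
  note [measurable] = centered_gaussian_process_measurable[OF gp]
  define r where "r = 2 powr (- \<gamma>')"
  have "r > 0" by (simp add: r_def)
  obtain q :: nat where q: "3 / (2 * (\<gamma> - \<gamma>')) < real q" using reals_Archimedean2 by blast
  moreover have "0 < 3 / (2 * (\<gamma> - \<gamma>'))" using \<open>\<gamma>' < \<gamma>\<close> by simp
  ultimately have "0 < q" by (cases q) auto
  \<comment> \<open>Three factors 2^-m are needed: by k + 1 <= 2^m (1 + s), turning (1 + s)^-2 into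
    the summable (k + 1)^-2 costs 2^(2m), and one factor 2^-m is left for the sum over the
    levels.\<close>
  have q3: "3 \<le> 2 * q * (\<gamma> - \<gamma>')" using q \<open>\<gamma>' < \<gamma>\<close> by (simp add: field_simps)
  define \<Delta> where "\<Delta> m k \<omega> = Y (real (Suc k) / 2 ^ m) \<omega> - Y (real k / 2 ^ m) \<omega>" for m k \<omega>
  \<comment> \<open>The standard deviation grows only like 1 + s. The surplus factor 1 + s in the
    weight becomes (1 + s)^(-2q) in the moment, and this makes the sum over infinitely many k
    converge.\<close>
  define W where "W m k = (1 + real k / 2 ^ m)\<^sup>2 * r ^ m" for m k
  have W0: "0 < W m k" for m k
    unfolding W_def using \<open>r > 0\<close> by (intro mult_pos_pos zero_less_power add_pos_nonneg) auto
  define U where "U m k \<omega> = ennreal ((\<Delta> m k \<omega> / W m k) ^ (2 * q))" for m k \<omega>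
  define S where "S \<omega> = (\<Sum>m. \<Sum>k. U m k \<omega>)" for \<omega>
  define A where "A = fact (2 * q) / (2 ^ q * fact q) * C ^ q"
  have [measurable]: "\<Delta> m k \<in> borel_measurable M" for m k
    unfolding \<Delta>_def by measurable
  have [measurable]: "U m k \<in> borel_measurable M" for m k unfolding U_def by measurable
  have mom: "(\<integral>\<^sup>+\<omega>. U m k \<omega> \<partial>M) \<le> ennreal (A * (1 / 2) ^ m / (real k + 1)\<^sup>2)" for m k
  proof -
    define s where "s = real k / 2 ^ m"
    define x where "x = (2::real) ^ m"
    have "1 \<le> x" unfolding x_def by (rule one_le_power) simp
    have "0 \<le> s" by (simp add: s_def)
    have step: "real (Suc k) / 2 ^ m - real k / 2 ^ m = 1 / x"
      unfolding x_def by (simp add: diff_divide_distrib[symmetric])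
    have Z: "centered_normal_rv M (\<Delta> m k)
        (K (real (Suc k) / 2 ^ m) (real (Suc k) / 2 ^ m) - K (real (Suc k) / 2 ^ m) (real k / 2 ^ m)
         - K (real k / 2 ^ m) (real (Suc k) / 2 ^ m) + K (real k / 2 ^ m) (real k / 2 ^ m))" (is "centered_normal_rv M _ ?v")
      unfolding \<Delta>_def by (rule centered_gaussian_process_increment[OF gp]) simp_all
    have "?v \<le> C * (1 + s)\<^sup>2 * (1 / x) powr (2 * \<gamma>)"
      using var[of "real k / 2 ^ m" "real (Suc k) / 2 ^ m"] \<open>1 \<le> x\<close> unfolding step s_def
      by (simp add: divide_right_mono)
    then have "(\<integral>\<^sup>+\<omega>. ennreal (\<Delta> m k \<omega> ^ (2 * q)) \<partial>M)
        \<le> ennreal (fact (2 * q) / (2 ^ q * fact q) * (C * (1 + s)\<^sup>2 * (1 / x) powr (2 * \<gamma>)) ^ q)"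
      using Z \<open>0 < q\<close> by (intro centered_normal_rv_even_moment_le)
    also have "fact (2 * q) / (2 ^ q * fact q) * (C * (1 + s)\<^sup>2 * (1 / x) powr (2 * \<gamma>)) ^ q
       = A * (1 + s) ^ (2 * q) * x powr (- (2 * \<gamma> * q))"
    proof -
      have "((1 / x) powr (2 * \<gamma>)) ^ q = x powr (- (2 * \<gamma> * q))"
      proof -
        have "((1 / x) powr (2 * \<gamma>)) ^ q = ((1 / x) powr (2 * \<gamma>)) powr real q"
          using \<open>1 \<le> x\<close> by (intro powr_realpow[symmetric]) simp
        also have "\<dots> = (1 / x) powr (2 * \<gamma> * q)" by (rule powr_powr)
        also have "\<dots> = x powr (- (2 * \<gamma> * q))"
          using \<open>1 \<le> x\<close> by (simp add: powr_divide powr_minus_divide)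
        finally show ?thesis .
      qed
      then show ?thesis by (simp add: A_def power_mult_distrib power_mult)
    qed
    finally have m1: "(\<integral>\<^sup>+\<omega>. ennreal (\<Delta> m k \<omega> ^ (2 * q)) \<partial>M) \<le> ennreal (A * (1 + s) ^ (2 * q) * x powr (- (2 * \<gamma> * q)))" .
    have "(\<integral>\<^sup>+\<omega>. U m k \<omega> \<partial>M) = (\<integral>\<^sup>+\<omega>. ennreal (1 / W m k ^ (2 * q)) * ennreal (\<Delta> m k \<omega> ^ (2 * q)) \<partial>M)"
      unfolding U_def using W0[of m k] by (intro nn_integral_cong) (simp add: ennreal_mult[symmetric] power_divide)
    also have "\<dots> = ennreal (1 / W m k ^ (2 * q)) * (\<integral>\<^sup>+\<omega>. ennreal (\<Delta> m k \<omega> ^ (2 * q)) \<partial>M)"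
      by (rule nn_integral_cmult) simp
    also have "\<dots> \<le> ennreal (1 / W m k ^ (2 * q)) * ennreal (A * (1 + s) ^ (2 * q) * x powr (- (2 * \<gamma> * q)))"
      by (intro mult_left_mono m1) simp
    also have "\<dots> = ennreal (1 / W m k ^ (2 * q) * (A * (1 + s) ^ (2 * q) * x powr (- (2 * \<gamma> * q))))"
      using W0[of m k] by (intro ennreal_mult'[symmetric]) simp
    also have "1 / W m k ^ (2 * q) * (A * (1 + s) ^ (2 * q) * x powr (- (2 * \<gamma> * q)))
       = A * (1 / (1 + s) ^ (2 * q)) * x powr (- (2 * q * (\<gamma> - \<gamma>')))"
    proof -
      have "(r ^ m) ^ (2 * q) = r powr (real m * real (2 * q))"
        unfolding power_mult[symmetric] of_nat_mult[symmetric] by (rule powr_realpow[symmetric]) fact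
      also have "\<dots> = (2 powr real m) powr (- (2 * q * \<gamma>'))"
        unfolding r_def powr_powr by (simp add: mult_ac)
      also have "2 powr real m = x" unfolding x_def by (rule powr_realpow) simp
      finally have "(r ^ m) ^ (2 * q) = x powr (- (2 * q * \<gamma>'))" .
      then have W: "W m k ^ (2 * q) = ((1 + s) ^ (2 * q))\<^sup>2 * x powr (- (2 * q * \<gamma>'))"
        unfolding W_def power_mult_distrib by (simp add: s_def power_mult[symmetric] mult.commute)
      have "x powr (- (2 * q * (\<gamma> - \<gamma>'))) = x powr (- (2 * \<gamma> * q)) / x powr (- (2 * q * \<gamma>'))"
        unfolding powr_diff[symmetric] by (simp add: algebra_simps)
      then show ?thesis unfolding W using \<open>0 \<le> s\<close> \<open>1 \<le> x\<close> by (simp add: power2_eq_square)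
    qed
    also have "\<dots> \<le> A * (x\<^sup>2 / (real k + 1)\<^sup>2) * (1 / x ^ 3)"
    proof -
      have "real k + 1 \<le> x * (1 + s)" using \<open>1 \<le> x\<close> by (simp add: s_def x_def algebra_simps)
      then have "(real k + 1)\<^sup>2 \<le> (x * (1 + s))\<^sup>2" by (intro power_mono) auto
      then have "1 / (1 + s)\<^sup>2 \<le> x\<^sup>2 / (real k + 1)\<^sup>2"
        using \<open>0 \<le> s\<close> by (simp add: divide_simps power_mult_distrib mult_ac)
      moreover have "(1 + s)\<^sup>2 \<le> (1 + s) ^ (2 * q)"
        using \<open>0 \<le> s\<close> \<open>0 < q\<close> by (intro power_increasing) auto
      then have "1 / (1 + s) ^ (2 * q) \<le> 1 / (1 + s)\<^sup>2"
        using \<open>0 \<le> s\<close> by (intro divide_left_mono) auto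
      ultimately have a: "1 / (1 + s) ^ (2 * q) \<le> x\<^sup>2 / (real k + 1)\<^sup>2" by linarith
      have "x powr (- (2 * q * (\<gamma> - \<gamma>'))) \<le> x powr (- 3)"
        using q3 \<open>1 \<le> x\<close> by (intro powr_mono) auto
      also have "\<dots> = 1 / x ^ 3" using \<open>1 \<le> x\<close> by (simp add: powr_minus_divide powr_numeral)
      finally have b: "x powr (- (2 * q * (\<gamma> - \<gamma>'))) \<le> 1 / x ^ 3" .
      have "0 \<le> A" using \<open>0 \<le> C\<close> by (simp add: A_def)
      then show ?thesis using a b \<open>1 \<le> x\<close> by (intro mult_mono mult_left_mono) auto
    qed
    also have "\<dots> = A * (1 / 2) ^ m / (real k + 1)\<^sup>2"
      using \<open>1 \<le> x\<close> unfolding power_one_over x_def[symmetric]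
      by (simp add: power2_eq_square power3_eq_cube)
    finally show ?thesis by (simp add: ennreal_leI)
  qed
  have "(\<integral>\<^sup>+\<omega>. S \<omega> \<partial>M) = (\<Sum>m. \<Sum>k. \<integral>\<^sup>+\<omega>. U m k \<omega> \<partial>M)"
    unfolding S_def by (simp add: nn_integral_suminf)
  also have "\<dots> \<le> (\<Sum>m. \<Sum>k. ennreal (A * (1 / 2) ^ m / (real k + 1)\<^sup>2))"
    by (intro suminf_le summableI mom)
  finally have "(\<integral>\<^sup>+\<omega>. S \<omega> \<partial>M) < \<infinity>"
    using suminf_geometric_inverse_squares_finite order.strict_trans1 by blast
  then have "AE \<omega> in M. S \<omega> \<noteq> \<infinity>"
    by (intro nn_integral_PInf_AE) (auto simp: S_def)
  then show ?thesis
  proof eventually_elim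
    case (elim \<omega>)
    \<comment> \<open>If |a|^(2q) <= S, then |a| <= max 1 S <= 1 + S, so no root has to be
      taken.\<close>
    define B where "B = 1 + enn2real (S \<omega>)"
    have "\<bar>\<Delta> m k \<omega>\<bar> \<le> B * W m k" for m k
    proof -
      have "U m k \<omega> \<le> (\<Sum>k. U m k \<omega>)"
        using sum_le_suminf[OF summableI, of "{k}" "\<lambda>k. U m k \<omega>"] by simp
      also have "\<dots> \<le> S \<omega>"
        unfolding S_def using sum_le_suminf[OF summableI, of "{m}" "\<lambda>m. \<Sum>k. U m k \<omega>"] by simp
      also have "S \<omega> = ennreal (enn2real (S \<omega>))" using elim by (simp add: less_top)
      finally have p: "\<bar>\<Delta> m k \<omega> / W m k\<bar> ^ (2 * q) \<le> enn2real (S \<omega>)"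
        unfolding U_def by (simp add: power_even_abs del: abs_divide)
      have "\<bar>\<Delta> m k \<omega> / W m k\<bar> \<le> B"
      proof (cases "\<bar>\<Delta> m k \<omega> / W m k\<bar> \<le> 1")
        case True
        then show ?thesis by (simp add: B_def add_increasing2)
      next
        case False
        then have "\<bar>\<Delta> m k \<omega> / W m k\<bar> ^ 1 \<le> \<bar>\<Delta> m k \<omega> / W m k\<bar> ^ (2 * q)"
          using \<open>0 < q\<close> by (intro power_increasing) auto
        then show ?thesis using p unfolding B_def power_one_right by linarith
      qed
      then show ?thesis using W0[of m k] by (simp add: abs_divide divide_le_eq)
    qed
    then show ?case
      by (intro exI[of _ B]) (auto simp: B_def \<Delta>_def W_def r_def mult.assoc)
  qed
qed

text \<open>The cube of a linear bound with rate c / 3.\<close>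

lemma cubic_le_exp:
  fixes c t :: real
  assumes "0 < c" "0 \<le> t"
  shows "(1 + t) ^ 3 \<le> (1 + 3 / c) ^ 3 * exp (c * t)"
proof -
  have "c / 3 * t \<le> exp (c / 3 * t)" using exp_ge_add_one_self[of "c / 3 * t"] by linarith
  then have "t \<le> 3 / c * exp (c / 3 * t)" using \<open>0 < c\<close> by (simp add: field_simps)
  moreover have "1 \<le> exp (c / 3 * t)" using assms by simp
  ultimately have "1 + t \<le> (1 + 3 / c) * exp (c / 3 * t)"
    unfolding distrib_right by linarith
  then have "(1 + t) ^ 3 \<le> ((1 + 3 / c) * exp (c / 3 * t)) ^ 3"
    using assms by (intro power_mono) auto
  also have "\<dots> = (1 + 3 / c) ^ 3 * exp (c * t)"
    by (simp add: power_mult_distrib exp_of_nat_mult[symmetric])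
  finally show ?thesis .
qed

text \<open>On [0, T] the weights are at most (1 + T)^2, so chaining gives a Hoelder constant
  quadratic in T. Applied with T at the right end of each unit step and summed along the integers,
  it yields cubic growth, which any exponential rate c > 0 dominates.\<close>

lemma path_regularity:
  fixes f :: "real \<Rightarrow> real" and B \<gamma> c :: real
  assumes cont: "continuous_on {0..} f" and "0 < \<gamma>" "0 \<le> B" "0 < c"
    and inc: "\<And>m k. \<bar>f (real (Suc k) / 2 ^ m) - f (real k / 2 ^ m)\<bar>
        \<le> B * (1 + real k / 2 ^ m)\<^sup>2 * (2 powr (- \<gamma>)) ^ m"
  shows "\<exists>C. \<forall>s t. 0 \<le> s \<longrightarrow> s \<le> t \<longrightarrow> t \<le> T \<longrightarrow> t - s \<le> 1 \<longrightarrow> \<bar>f t - f s\<bar> \<le> C * (t - s) powr \<gamma>"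
    and "\<exists>K. \<forall>t\<ge>0. \<bar>f t\<bar> \<le> K * exp (c * t)"
proof -
  define r where "r = 2 powr (- \<gamma>)"
  have r: "0 < r" "r < 1" using \<open>0 < \<gamma>\<close> by (auto simp: r_def powr_less_one)
  define Q where "Q = B * (2 / (r * (1 - r)))"
  have "0 \<le> Q" using r \<open>0 \<le> B\<close> by (simp add: Q_def)
  have hol: "\<bar>f t - f s\<bar> \<le> (1 + T)\<^sup>2 * Q * (t - s) powr \<gamma>"
    if "0 \<le> s" "s \<le> t" "t \<le> T" "t - s \<le> 1" for s t T
  proof -
    have "\<bar>f t - f s\<bar> \<le> (B * (1 + T)\<^sup>2) * (2 / (r * (1 - r))) * (t - s) powr \<gamma>"
      unfolding r_def
    proof (rule Hoelder_of_dyadic_increments)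
      show "continuous_on {0..T} f" by (rule continuous_on_subset[OF cont]) auto
      fix m k assume k: "real (Suc k) / 2 ^ m \<le> T"
      have "real k / 2 ^ m \<le> real (Suc k) / 2 ^ m" by (intro divide_right_mono) auto
      then have "(1 + real k / 2 ^ m)\<^sup>2 \<le> (1 + T)\<^sup>2" using k by (intro power_mono) auto
      then have "B * (1 + real k / 2 ^ m)\<^sup>2 * (2 powr (- \<gamma>)) ^ m \<le> B * (1 + T)\<^sup>2 * (2 powr (- \<gamma>)) ^ m"
        using \<open>0 \<le> B\<close> by (intro mult_left_mono mult_right_mono) auto
      then show "\<bar>f (real (Suc k) / 2 ^ m) - f (real k / 2 ^ m)\<bar> \<le> B * (1 + T)\<^sup>2 * (2 powr (- \<gamma>)) ^ m"
        using inc[of k m] by linarith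
    qed (use that \<open>0 < \<gamma>\<close> \<open>0 \<le> B\<close> in auto)
    then show ?thesis by (simp add: Q_def mult_ac)
  qed
  then show "\<exists>C. \<forall>s t. 0 \<le> s \<longrightarrow> s \<le> t \<longrightarrow> t \<le> T \<longrightarrow> t - s \<le> 1 \<longrightarrow> \<bar>f t - f s\<bar> \<le> C * (t - s) powr \<gamma>"
    by blast
  have unit: "\<bar>f t - f s\<bar> \<le> (1 + t)\<^sup>2 * Q" if "0 \<le> s" "s \<le> t" "t - s \<le> 1" for s t
  proof -
    have "\<bar>f t - f s\<bar> \<le> (1 + t)\<^sup>2 * Q * (t - s) powr \<gamma>" by (rule hol) (use that in auto)
    also have "\<dots> \<le> (1 + t)\<^sup>2 * Q * 1"
      using that \<open>0 \<le> Q\<close> \<open>0 < \<gamma>\<close> by (intro mult_left_mono powr_le1) auto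
    finally show ?thesis by simp
  qed
  have nat: "\<bar>f (real n)\<bar> \<le> \<bar>f 0\<bar> + real n * (1 + real n)\<^sup>2 * Q" for n
  proof (induction n)
    case (Suc n)
    have "real n * (1 + real n)\<^sup>2 \<le> real n * (1 + real (Suc n))\<^sup>2"
      by (intro mult_left_mono power_mono) auto
    from mult_right_mono[OF this \<open>0 \<le> Q\<close>] have "real n * (1 + real n)\<^sup>2 * Q \<le> real n * (1 + real (Suc n))\<^sup>2 * Q" .
    moreover have "\<bar>f (real (Suc n)) - f (real n)\<bar> \<le> (1 + real (Suc n))\<^sup>2 * Q" by (rule unit) auto
    moreover have "real (Suc n) * (1 + real (Suc n))\<^sup>2 * Q = real n * (1 + real (Suc n))\<^sup>2 * Q + (1 + real (Suc n))\<^sup>2 * Q"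
      by (simp add: distrib_right)
    ultimately show ?case using Suc by linarith
  qed simp
  have "\<bar>f t\<bar> \<le> ((\<bar>f 0\<bar> + Q) * (1 + 3 / c) ^ 3) * exp (c * t)" if "0 \<le> t" for t
  proof -
    define n where "n = nat \<lfloor>t\<rfloor>"
    have n: "real n \<le> t" "t - real n \<le> 1" using that unfolding n_def by linarith+
    have "real n * (1 + real n)\<^sup>2 * Q \<le> t * (1 + t)\<^sup>2 * Q"
      using n that \<open>0 \<le> Q\<close> by (intro mult_right_mono mult_mono power_mono) auto
    then have "\<bar>f t\<bar> \<le> \<bar>f 0\<bar> + t * (1 + t)\<^sup>2 * Q + (1 + t)\<^sup>2 * Q"
      using nat[of n] unit[of "real n" t] n by linarith
    also have "\<dots> = \<bar>f 0\<bar> * 1 + Q * (1 + t) ^ 3"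
      by (simp add: power2_eq_square power3_eq_cube algebra_simps)
    also have "\<dots> \<le> \<bar>f 0\<bar> * (1 + t) ^ 3 + Q * (1 + t) ^ 3"
      using that \<open>0 \<le> Q\<close> by (intro add_mono mult_left_mono one_le_power) auto
    also have "\<dots> = (\<bar>f 0\<bar> + Q) * (1 + t) ^ 3" by (simp add: distrib_right)
    also have "\<dots> \<le> (\<bar>f 0\<bar> + Q) * ((1 + 3 / c) ^ 3 * exp (c * t))"
      using cubic_le_exp[OF \<open>0 < c\<close> that] \<open>0 \<le> Q\<close> by (intro mult_left_mono) auto
    finally show ?thesis by (simp add: mult.assoc)
  qed
  then show "\<exists>K. \<forall>t\<ge>0. \<bar>f t\<bar> \<le> K * exp (c * t)" by blast
qed

section \<open>Nondegeneracy of the limit\<close>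

text \<open>Left-endpoint sums; the integer upper limit lets n * k cells of length 1 / k fit
  exactly. Uniform continuity bounds the error on each cell by e' / k, and \<open>part\<close> adds
  these up cell by cell.\<close>

lemma Riemann_sum_tendsto:
  fixes f :: "real \<Rightarrow> real"
  assumes cont: "continuous_on {0..real n} f"
  shows "(\<lambda>k. \<Sum>i<n * k. f (real i / real k) / real k) \<longlonglongrightarrow> integral {0..real n} f"
proof (rule LIMSEQ_I)
  fix e :: real assume "0 < e"
  define e' where "e' = e / (real n + 1)"
  have "0 < e'" using \<open>0 < e\<close> by (simp add: e'_def add_nonneg_pos)
  have "uniformly_continuous_on {0..real n} f"
    using cont by (rule compact_uniformly_continuous) simp
  then obtain d where "d > 0" and d: "\<And>x y. x \<in> {0..real n} \<Longrightarrow> y \<in> {0..real n} \<Longrightarrow> \<bar>x - y\<bar> < d \<Longrightarrow> \<bar>f x - f y\<bar> < e'"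
    using \<open>0 < e'\<close> unfolding uniformly_continuous_on_def dist_real_def by metis
  obtain N :: nat where N: "1 / d < real N" using reals_Archimedean2 by blast
  show "\<exists>no. \<forall>k\<ge>no. norm ((\<Sum>i<n * k. f (real i / real k) / real k) - integral {0..real n} f) < e"
  proof (intro exI allI impI)
    fix k assume "k \<ge> N"
    with N \<open>d > 0\<close> have "1 / d < real k" by (meson less_le_trans of_nat_le_iff)
    moreover have "0 < 1 / d" using \<open>d > 0\<close> by simp
    ultimately have "0 < k" by (cases k) auto
    have kd: "1 / real k < d" using \<open>1 / d < real k\<close> \<open>0 < k\<close> \<open>d > 0\<close> by (simp add: field_simps)
    have part: "\<bar>(\<Sum>i<j. f (real i / real k) / real k) - integral {0..real j / real k} f\<bar> \<le> real j * (e' / real k)"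
      if "j \<le> n * k" for j
      using that
    proof (induction j)
      case (Suc j)
      define a where "a = real j / real k"
      define b where "b = real (Suc j) / real k"
      have ab: "0 \<le> a" "a \<le> b" "b - a = 1 / real k"
        by (auto simp: a_def b_def divide_right_mono diff_divide_distrib[symmetric])
      have "real (Suc j) \<le> real (n * k)" using Suc.prems by (simp only: of_nat_le_iff)
      then have bn: "b \<le> real n" using \<open>0 < k\<close> by (simp add: b_def divide_le_eq)
      have int: "f integrable_on {x..y}" if "0 \<le> x" "y \<le> b" for x y
        using bn that by (intro integrable_continuous_interval continuous_on_subset[OF cont]) auto
      have "integral {0..a} f + integral {a..b} f = integral {0..b} f"
        by (rule Henstock_Kurzweil_Integration.integral_combine) (use ab in \<open>auto intro: int\<close>)
      moreover have "\<bar>f a / real k - integral {a..b} f\<bar> \<le> e' / real k"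
      proof -
        have c: "integral {a..b} (\<lambda>x. f a) = f a / real k" using ab by simp
        have "integral {a..b} (\<lambda>x. f a - f x) = f a / real k - integral {a..b} f"
          using ab int[of a b] by (subst Henstock_Kurzweil_Integration.integral_diff) (auto simp: c)
        moreover have "norm (integral {a..b} (\<lambda>x. f a - f x)) \<le> e' * (b - a)"
        proof (rule integral_bound[OF ab(2)])
          show "continuous_on {a..b} (\<lambda>x. f a - f x)"
            using ab bn by (intro continuous_intros continuous_on_subset[OF cont]) auto
          show "norm (f a - f x) \<le> e'" if "x \<in> {a..b}" for x
            using d[of a x] that ab bn kd by auto
        qed
        ultimately show ?thesis using ab by simp
      qed
      moreover have "\<bar>(\<Sum>i<j. f (real i / real k) / real k) - integral {0..a} f\<bar> \<le> real j * (e' / real k)"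
        using Suc unfolding a_def by simp
      moreover have "real (Suc j) * (e' / real k) = real j * (e' / real k) + e' / real k" by (simp add: distrib_right add_divide_distrib)
      moreover have "(\<Sum>i<Suc j. f (real i / real k) / real k) = (\<Sum>i<j. f (real i / real k) / real k) + f a / real k"
        by (simp add: a_def)
      ultimately show ?case unfolding b_def[symmetric] by linarith
    qed simp
    have "\<bar>(\<Sum>i<n * k. f (real i / real k) / real k) - integral {0..real n} f\<bar> \<le> real n * e'"
      using part[of "n * k"] \<open>0 < k\<close> by simp
    also have "\<dots> < e" using \<open>0 < e\<close> by (simp add: e'_def divide_less_eq)
    finally show "norm ((\<Sum>i<n * k. f (real i / real k) / real k) - integral {0..real n} f) < e" by simp
  qed
qed

text \<open>The density is at most 1 / sqrt(2 pi w) everywhere, so the bound is uniform in the shift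
  \<open>a\<close>, which later carries the contribution of x0.\<close>

lemma normal_anticoncentration:
  assumes Z: "centered_normal_rv M Z v" and "w \<le> v" "0 < w" "0 < \<epsilon>"
  shows "emeasure M {\<omega> \<in> space M. \<bar>a + Z \<omega>\<bar> < \<epsilon>} \<le> ennreal (2 * \<epsilon> / sqrt (2 * pi * w))"
proof -
  have "v > 0" and dist: "distributed M lborel Z (normal_density 0 (sqrt v))"
    using assms by (auto simp: centered_normal_rv_def split: if_splits)
  let ?I = "{- a - \<epsilon><..<- a + \<epsilon>}"
  have "{\<omega> \<in> space M. \<bar>a + Z \<omega>\<bar> < \<epsilon>} = Z -` ?I \<inter> space M" by auto
  then have "emeasure M {\<omega> \<in> space M. \<bar>a + Z \<omega>\<bar> < \<epsilon>} = (\<integral>\<^sup>+x. ennreal (normal_density 0 (sqrt v) x) * indicator ?I x \<partial>lborel)"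
    using distributed_emeasure[OF dist, of ?I] by simp
  also have "\<dots> \<le> (\<integral>\<^sup>+x. ennreal (1 / sqrt (2 * pi * w)) * indicator ?I x \<partial>lborel)"
  proof (intro nn_integral_mono mult_right_mono ennreal_leI)
    fix x
    have "1 / sqrt (2 * pi * v) * exp (- (x - 0)\<^sup>2 / (2 * v)) \<le> 1 / sqrt (2 * pi * w) * 1"
      using assms \<open>v > 0\<close> by (intro mult_mono divide_left_mono real_sqrt_le_mono mult_pos_pos) auto
    then show "normal_density 0 (sqrt v) x \<le> 1 / sqrt (2 * pi * w)"
      using \<open>v > 0\<close> by (simp add: normal_density_def)
  qed simp
  also have "\<dots> = ennreal (1 / sqrt (2 * pi * w)) * ennreal (2 * \<epsilon>)"
    using \<open>0 < \<epsilon>\<close> by (simp add: nn_integral_cmult_indicator)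
  also have "\<dots> = ennreal (2 * \<epsilon> / sqrt (2 * pi * w))"
    using assms by (simp add: ennreal_mult[symmetric])
  finally show ?thesis .
qed

text \<open>Fatou's lemma for indicators: since the ball is open, |Z'| < eps forces |Z n| < eps
  eventually. It is applied twice, for the mesh tending to 0 and for the horizon tending to
  infinity.\<close>

lemma emeasure_small_ball_limit:
  fixes Z :: "nat \<Rightarrow> 'a \<Rightarrow> real"
  assumes [measurable]: "\<And>n. Z n \<in> borel_measurable M" "Z' \<in> borel_measurable M"
    and lim: "AE \<omega> in M. (\<lambda>n. Z n \<omega>) \<longlonglongrightarrow> Z' \<omega>"
    and bound: "eventually (\<lambda>n. emeasure M {\<omega> \<in> space M. \<bar>Z n \<omega>\<bar> < \<epsilon>} \<le> b) sequentially"
  shows "emeasure M {\<omega> \<in> space M. \<bar>Z' \<omega>\<bar> < \<epsilon>} \<le> b"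
proof -
  let ?A = "\<lambda>n. {\<omega> \<in> space M. \<bar>Z n \<omega>\<bar> < \<epsilon>}"
  have "emeasure M {\<omega> \<in> space M. \<bar>Z' \<omega>\<bar> < \<epsilon>} = (\<integral>\<^sup>+\<omega>. indicator {\<omega> \<in> space M. \<bar>Z' \<omega>\<bar> < \<epsilon>} \<omega> \<partial>M)"
    by simp
  also have "\<dots> \<le> (\<integral>\<^sup>+\<omega>. liminf (\<lambda>n. indicator (?A n) \<omega>) \<partial>M)"
  proof (rule nn_integral_mono_AE, use lim AE_space in eventually_elim)
    case (elim \<omega>)
    show ?case
    proof (cases "\<bar>Z' \<omega>\<bar> < \<epsilon>")
      case True
      have "(\<lambda>n. \<bar>Z n \<omega>\<bar>) \<longlonglongrightarrow> \<bar>Z' \<omega>\<bar>" using elim by (intro tendsto_intros) auto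
      then have "eventually (\<lambda>n. \<bar>Z n \<omega>\<bar> < \<epsilon>) sequentially"
        using True by (rule order_tendstoD(2))
      then have "eventually (\<lambda>n. (1::ennreal) \<le> indicator (?A n) \<omega>) sequentially"
        by eventually_elim (use elim in simp)
      then have "(1::ennreal) \<le> liminf (\<lambda>n. indicator (?A n) \<omega>)" by (rule Liminf_bounded)
      then show ?thesis using True elim by simp
    qed simp
  qed
  also have "\<dots> \<le> liminf (\<lambda>n. \<integral>\<^sup>+\<omega>. indicator (?A n) \<omega> \<partial>M)"
    by (rule nn_integral_liminf) simp
  also have "\<dots> = liminf (\<lambda>n. emeasure M (?A n))" by simp
  also have "\<dots> \<le> limsup (\<lambda>n. emeasure M (?A n))" by (rule Liminf_le_Limsup) simp
  also have "\<dots> \<le> b" by (rule Limsup_bounded[OF bound])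
  finally show ?thesis .
qed

lemma AE_nonzero_of_small_ball:
  fixes Z :: "'a \<Rightarrow> real"
  assumes [measurable]: "Z \<in> borel_measurable M"
    and small: "\<And>\<epsilon>. 0 < \<epsilon> \<Longrightarrow> emeasure M {\<omega> \<in> space M. \<bar>Z \<omega>\<bar> < \<epsilon>} \<le> ennreal (c * \<epsilon>)"
  shows "AE \<omega> in M. Z \<omega> \<noteq> 0"
proof -
  let ?N = "{\<omega> \<in> space M. Z \<omega> = 0}"
  have le: "emeasure M ?N \<le> ennreal (c * \<epsilon>)" if "0 < \<epsilon>" for \<epsilon>
  proof -
    have "emeasure M ?N \<le> emeasure M {\<omega> \<in> space M. \<bar>Z \<omega>\<bar> < \<epsilon>}"
      using that by (intro emeasure_mono) auto
    then show ?thesis using small[OF that] by (rule order_trans)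
  qed
  have "emeasure M ?N \<le> ennreal (c * (1 / real (Suc n)))" for n by (rule le) simp
  moreover have "(\<lambda>n. ennreal (c * (1 / real (Suc n)))) \<longlonglongrightarrow> ennreal (c * 0)"
    by (intro tendsto_ennrealI tendsto_intros LIMSEQ_Suc lim_1_over_n)
  ultimately have "emeasure M ?N \<le> ennreal (c * 0)"
    by (intro tendsto_lowerbound[where F = sequentially]) auto
  then have "emeasure M ?N = 0" by simp
  then show ?thesis by (subst AE_iff_measurable[OF _ refl]) auto
qed

text \<open>Riemann sums of \<open>\<integral>\<^bsub>0\<^esub>\<^bsup>n\<^esup> e\<^bsup>-\<theta>s\<^esup> (x0 + Y s) ds\<close> are Gaussian with variance bounded below
uniformly in \<open>n\<close> and in the mesh; such a small-ball bound survives almost sure limits.\<close>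
lemma AE_discounted_integral_limit_nonzero:
  fixes Y :: "real \<Rightarrow> 'a \<Rightarrow> real" and H :: "real \<Rightarrow> real" and L :: "'a \<Rightarrow> real" and \<theta> x0 h1 h2 :: real
  assumes h: "0 < h1" "h1 \<le> h2" "h2 < 1" and H: "\<And>t. 0 \<le> t \<Longrightarrow> h1 \<le> H t \<and> H t \<le> h2"
    and gp: "centered_gaussian_process M Y (mbm_cov H)"
    and cont: "AE \<omega> in M. continuous_on {0..} (\<lambda>t. Y t \<omega>)"
    and L: "AE \<omega> in M. ((\<lambda>T. integral {0..T} (\<lambda>s. exp (- \<theta> * s) * (x0 + Y s \<omega>))) \<longlongrightarrow> L \<omega>) at_top"
    and "0 < \<theta>"
  shows "AE \<omega> in M. L \<omega> \<noteq> 0"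
proof -
  note meas = centered_gaussian_process_measurable[OF gp]
  \<comment> \<open>The bound of \<open>mbm_cov_quadratic_form_ge\<close>, with the total weight of
    the times in [1, 2] replaced by exp(-2 theta), the least discount factor there.\<close>
  define w where "w = ((1 - cos (1/2)) * exp (- \<theta> * 2))\<^sup>2 / (4 * pi)"
  have "cos (1/2) < cos (0::real)" using pi_gt3 by (intro cos_monotone_0_pi) auto
  then have c0: "0 < 1 - cos (1/2 :: real)" by simp
  then have "0 < w" by (simp add: w_def)
  define c where "c = 2 / sqrt (2 * pi * w)"
  define R where "R n k \<omega> = (\<Sum>i<n * k. exp (- \<theta> * (real i / real k)) * (x0 + Y (real i / real k) \<omega>) / real k)" for n k \<omega>
  \<comment> \<open>\<open>L\<close> is given only up to null sets and without measurability.
    Iterated \<open>lim\<close> of the measurable sums gives a measurable \<open>J\<close> that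
    agrees with it almost surely.\<close>
  define I where "I n \<omega> = lim (\<lambda>k. R n k \<omega>)" for n \<omega>
  define J where "J \<omega> = lim (\<lambda>n. I n \<omega>)" for \<omega>
  have R_meas [measurable]: "R n k \<in> borel_measurable M" for n k
    unfolding R_def by (intro borel_measurable_sum borel_measurable_divide borel_measurable_times borel_measurable_add
        borel_measurable_const meas) auto
  have [measurable]: "I n \<in> borel_measurable M" for n unfolding I_def by measurable
  have [measurable]: "J \<in> borel_measurable M" unfolding J_def by measurable
  have R_lim: "(\<lambda>k. R n k \<omega>) \<longlonglongrightarrow> integral {0..real n} (\<lambda>s. exp (- \<theta> * s) * (x0 + Y s \<omega>))"
    if "continuous_on {0..} (\<lambda>t. Y t \<omega>)" for n \<omega>
    unfolding R_def
    by (rule Riemann_sum_tendsto) (intro continuous_intros continuous_on_subset[OF that]; auto)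
  have I_eq: "I n \<omega> = integral {0..real n} (\<lambda>s. exp (- \<theta> * s) * (x0 + Y s \<omega>))"
    if "continuous_on {0..} (\<lambda>t. Y t \<omega>)" for n \<omega>
    unfolding I_def using R_lim[OF that] by (rule limI)
  have small_R: "emeasure M {\<omega> \<in> space M. \<bar>R n k \<omega>\<bar> < \<epsilon>} \<le> ennreal (c * \<epsilon>)"
    if "2 \<le> n" "0 < k" "0 < \<epsilon>" for n k \<epsilon>
  proof -
    define ts where "ts i = real i / real k" for i
    define cs where "cs i = exp (- \<theta> * ts i) / real k" for i
    define v where "v = (\<Sum>i<n * k. \<Sum>j<n * k. cs i * cs j * mbm_cov H (ts i) (ts j))"
    have normal: "centered_normal_rv M (\<lambda>\<omega>. \<Sum>i<n * k. cs i * Y (ts i) \<omega>) v"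
      unfolding v_def using gp[unfolded centered_gaussian_process_def, rule_format, of "n * k" ts cs]
      by (simp add: ts_def)
    have "exp (- \<theta> * 2) \<le> (\<Sum>i | i < n * k \<and> ts i \<in> {1..2}. cs i)"
    proof -
      \<comment> \<open>These k grid points lie in [1, 2) and, as n >= 2, within the horizon; each
        has weight at least exp(-2 theta) / k.\<close>
      have sub: "{k..<2 * k} \<subseteq> {i. i < n * k \<and> ts i \<in> {1..2}}"
        using that by (auto simp: ts_def divide_simps intro: less_le_trans[OF _ mult_right_mono])
      have "exp (- \<theta> * 2) = (\<Sum>i\<in>{k..<2 * k}. exp (- \<theta> * 2) / real k)" using that by simp
      also have "\<dots> \<le> (\<Sum>i\<in>{k..<2 * k}. cs i)"
        unfolding cs_def using sub \<open>0 < \<theta>\<close> by (intro sum_mono divide_right_mono) (auto simp: subset_eq)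
      also have "\<dots> \<le> (\<Sum>i | i < n * k \<and> ts i \<in> {1..2}. cs i)"
        by (intro sum_mono2 sub) (auto simp: cs_def)
      finally show ?thesis .
    qed
    then have "w \<le> ((1 - cos (1/2)) * (\<Sum>i | i < n * k \<and> ts i \<in> {1..2}. cs i))\<^sup>2 / (4 * pi)"
      unfolding w_def using c0 by (intro divide_right_mono power_mono mult_left_mono) auto
    also have "\<dots> \<le> v"
      unfolding v_def by (rule mbm_cov_quadratic_form_ge[OF h H]) (auto simp: ts_def cs_def)
    finally have "w \<le> v" .
    have "R n k \<omega> = (\<Sum>i<n * k. cs i * x0) + (\<Sum>i<n * k. cs i * Y (ts i) \<omega>)" for \<omega>
      unfolding R_def sum.distrib[symmetric]
      by (intro sum.cong refl) (simp add: ts_def cs_def distrib_left add_divide_distrib)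
    then show ?thesis
      using normal_anticoncentration[OF normal \<open>w \<le> v\<close> \<open>0 < w\<close> \<open>0 < \<epsilon>\<close>] by (simp add: c_def)
  qed
  have small_I: "emeasure M {\<omega> \<in> space M. \<bar>I n \<omega>\<bar> < \<epsilon>} \<le> ennreal (c * \<epsilon>)" if "2 \<le> n" "0 < \<epsilon>" for n \<epsilon>
  proof (rule emeasure_small_ball_limit)
    show "AE \<omega> in M. (\<lambda>k. R n k \<omega>) \<longlonglongrightarrow> I n \<omega>"
      using cont by eventually_elim (simp only: I_eq R_lim)
    show "eventually (\<lambda>k. emeasure M {\<omega> \<in> space M. \<bar>R n k \<omega>\<bar> < \<epsilon>} \<le> ennreal (c * \<epsilon>)) sequentially"
      using eventually_gt_at_top[of 0] by eventually_elim (rule small_R[OF that(1) _ that(2)])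
  qed measurable
  have I_lim: "AE \<omega> in M. (\<lambda>n. I n \<omega>) \<longlonglongrightarrow> L \<omega>"
    using cont L
  proof eventually_elim
    case (elim \<omega>)
    show ?case unfolding I_eq[OF elim(1)]
      by (rule filterlim_compose[OF elim(2) filterlim_real_sequentially])
  qed
  then have JL: "AE \<omega> in M. J \<omega> = L \<omega>" by eventually_elim (simp add: J_def limI)
  have "emeasure M {\<omega> \<in> space M. \<bar>J \<omega>\<bar> < \<epsilon>} \<le> ennreal (c * \<epsilon>)" if "0 < \<epsilon>" for \<epsilon>
  proof (rule emeasure_small_ball_limit)
    show "AE \<omega> in M. (\<lambda>n. I n \<omega>) \<longlonglongrightarrow> J \<omega>" using I_lim JL by eventually_elim simp
    show "eventually (\<lambda>n. emeasure M {\<omega> \<in> space M. \<bar>I n \<omega>\<bar> < \<epsilon>} \<le> ennreal (c * \<epsilon>)) sequentially"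
      using eventually_ge_at_top[of 2] by eventually_elim (rule small_I[OF _ that])
  qed measurable
  then have "AE \<omega> in M. J \<omega> \<noteq> 0" by (intro AE_nonzero_of_small_ball) measurable
  then show ?thesis using JL by eventually_elim simp
qed

theorem theorem11:
  fixes M :: "'a measure" and H :: "real \<Rightarrow> real" and Y X :: "real \<Rightarrow> 'a \<Rightarrow> real"
    and h1 h2 D \<kappa> x0 \<theta> :: real
  assumes "prob_space M"
    and "continuous_on {0..} H"
    and "0 < h1" "h1 < h2" "h2 < 1"
    and "\<And>t. t \<ge> 0 \<Longrightarrow> h1 \<le> H t \<and> H t \<le> h2"
    and "D > 0" "0 < \<kappa>" "\<kappa> \<le> 1"
    and "\<And>t s. 0 < s \<Longrightarrow> s \<le> t \<Longrightarrow> \<bar>H t - H s\<bar> \<le> D * (t - s) powr \<kappa>"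
    and "min h1 \<kappa> > 1/2"
    and "mbm M H Y"
    and "\<theta> > 0"
    and "AE \<omega> in M. continuous_on {0..} (\<lambda>t. X t \<omega>) \<and>
           (\<forall>t\<ge>0. X t \<omega> = x0 + \<theta> * integral {0..t} (\<lambda>s. X s \<omega>) + Y t \<omega>)"
  shows "AE \<omega> in M. ((\<lambda>T. RS_integral (\<lambda>s. X s \<omega>) (\<lambda>s. X s \<omega>) T
                          / integral {0..T} (\<lambda>s. (X s \<omega>)\<^sup>2)) \<longlongrightarrow> \<theta>) at_top"
proof -
  note H = assms(6) and sol = assms(14)
  have gp: "centered_gaussian_process M Y (mbm_cov H)"
    and contY: "AE \<omega> in M. continuous_on {0..} (\<lambda>t. Y t \<omega>)"
    using \<open>mbm M H Y\<close> by (auto simp: mbm_def)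
  define m where "m = min h1 \<kappa>"
  have m: "1/2 < m" "m \<le> h1" "m \<le> \<kappa>" using assms(11) by (simp_all add: m_def)
  \<comment> \<open>The slack above 1/2 is spent in portions of eta: one absorbs the logarithm from
    the varying exponent (giving \<open>\<gamma>\<close>), one is lost in chaining (giving
    \<open>\<gamma>'\<close>), and the third keeps \<open>\<gamma>'\<close> strictly above 1/2. The
    other entry of the minimum secures h2 + eta < 1.\<close>
  define \<eta> where "\<eta> = min (m - 1/2) (1 - h2) / 3"
  have "0 < \<eta>" using m assms(5) by (simp add: \<eta>_def)
  have "3 * \<eta> \<le> m - 1/2" "3 * \<eta> \<le> 1 - h2" by (simp_all add: \<eta>_def)
  then have \<eta>: "h2 + \<eta> < 1" "1/2 < m - 2 * \<eta>" using \<open>0 < \<eta>\<close> by linarith+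
  define \<gamma> where "\<gamma> = m - \<eta>"
  define \<gamma>' where "\<gamma>' = m - 2 * \<eta>"
  have \<gamma>: "0 < \<gamma>" "\<gamma> + \<eta> \<le> h1" "\<gamma> \<le> \<kappa>" "\<gamma>' < \<gamma>" "1/2 < \<gamma>'" "\<gamma>' \<le> 1"
    using \<eta> m \<open>0 < \<eta>\<close> \<open>\<kappa> \<le> 1\<close> unfolding \<gamma>_def \<gamma>'_def by linarith+
  obtain C where "0 \<le> C" and C: "\<And>s t. 0 \<le> s \<Longrightarrow> s \<le> t \<Longrightarrow> t - s \<le> 1 \<Longrightarrow>
      mbm_cov H t t - mbm_cov H t s - mbm_cov H s t + mbm_cov H s s \<le> C * (1 + s)\<^sup>2 * (t - s) powr (2 * \<gamma>)"
    using mbm_increment_variance_le[OF assms(3) less_imp_le[OF assms(4)] assms(5) H assms(10) \<open>0 < \<eta>\<close> \<gamma>(2) \<eta>(1) \<gamma>(1,3)]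
    by metis
  \<comment> \<open>A total function of the sample point; it is the genuine limit only on the almost
    sure event where that limit exists.\<close>
  define L where "L \<omega> = Lim at_top (\<lambda>T. integral {0..T} (\<lambda>s. exp (- \<theta> * s) * (x0 + Y s \<omega>)))" for \<omega>
  have dyadic: "AE \<omega> in M. \<exists>B\<ge>0. \<forall>m k. \<bar>Y (real (Suc k) / 2 ^ m) \<omega> - Y (real k / 2 ^ m) \<omega>\<bar>
      \<le> B * (1 + real k / 2 ^ m)\<^sup>2 * (2 powr (- \<gamma>')) ^ m"
    by (rule AE_dyadic_increments_bounded[OF gp \<open>0 \<le> C\<close> \<gamma>(4) C])
  have reg: "AE \<omega> in M.
      (\<forall>T. \<exists>C. \<forall>s t. 0 \<le> s \<longrightarrow> s \<le> t \<longrightarrow> t \<le> T \<longrightarrow> t - s \<le> 1 \<longrightarrow> \<bar>Y t \<omega> - Y s \<omega>\<bar> \<le> C * (t - s) powr \<gamma>')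
      \<and> (\<exists>K. \<forall>t\<ge>0. \<bar>Y t \<omega>\<bar> \<le> K * exp (\<theta> / 2 * t))"
    using contY dyadic
  proof eventually_elim
    case (elim \<omega>)
    then obtain B where "0 \<le> B" and B: "\<And>m k. \<bar>Y (real (Suc k) / 2 ^ m) \<omega> - Y (real k / 2 ^ m) \<omega>\<bar>
      \<le> B * (1 + real k / 2 ^ m)\<^sup>2 * (2 powr (- \<gamma>')) ^ m" by blast
    have "0 < \<gamma>'" "0 < \<theta> / 2" using \<gamma> \<open>\<theta> > 0\<close> by auto
    from path_regularity[where f = "\<lambda>t. Y t \<omega>", OF elim(1) this(1) \<open>0 \<le> B\<close> this(2) B] show ?case by blast
  qed
  have L: "AE \<omega> in M. ((\<lambda>T. integral {0..T} (\<lambda>s. exp (- \<theta> * s) * (x0 + Y s \<omega>))) \<longlongrightarrow> L \<omega>) at_top"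
    using contY reg
  proof eventually_elim
    case (elim \<omega>)
    then obtain K where "\<And>t. 0 \<le> t \<Longrightarrow> \<bar>Y t \<omega>\<bar> \<le> K * exp (\<theta> / 2 * t)" by blast
    from discounted_integral_tendsto[OF elim(1) \<open>\<theta> > 0\<close> this, of x0]
    obtain l where l: "((\<lambda>T. integral {0..T} (\<lambda>s. exp (- \<theta> * s) * (x0 + Y s \<omega>))) \<longlongrightarrow> l) at_top" by blast
    then have "L \<omega> = l" unfolding L_def by (intro tendsto_Lim) auto
    with l show ?case by simp
  qed
  have "AE \<omega> in M. L \<omega> \<noteq> 0"
    by (rule AE_discounted_integral_limit_nonzero[OF assms(3) less_imp_le[OF assms(4)] assms(5) H gp contY L \<open>\<theta> > 0\<close>])
  with sol reg L show ?thesis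
  proof eventually_elim
    case (elim \<omega>)
    then obtain K where K: "\<And>t. 0 \<le> t \<Longrightarrow> \<bar>Y t \<omega>\<bar> \<le> K * exp (\<theta> / 2 * t)" by blast
    show ?case
      by (rule estimator_tendsto_pathwise[where Y = "\<lambda>t. Y t \<omega>" and L = "L \<omega>", OF _ \<open>\<theta> > 0\<close> \<gamma>(5,6) _ K])
        (use elim in auto)
  qed
qed

end
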